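(* Let $w:\mathbb{R}^n\to(0,\infty]$ be lower semicontinuous and let $\Omega\subseteq\mathbb{R}^n$ be open. Let $\Omega_w=\{(x,y)\in\mathbb{R}^n\times\mathbb{R}:x\in\Omega,\ 0<y<w(x)\}$ and, for $f\in L^1(\Omega;w)$, define $Jf:\Omega_w\to\mathbb{R}$ by $Jf(x,y)=f(x)$. Then $J:BV(\Omega;w)\to BV(\Omega_w)$ is an isometric embedding. That is, $J$ maps $BV(\Omega;w)$ into $BV(\Omega_w)$, it is injective, and for all $f\in BV(\Omega;w)$, $$\lVert f\rVert_{L^1(\Omega;w)}=\lVert Jf\rVert_{L^1(\Omega_w)}\qquad\text{and}\qquad\lVert Df\rVert_w(\Omega)=\lVert D(Jf)\rVert(\Omega_w).$$
   Context: $\mathrm{Lip}_c(\Omega;\mathbb{R}^n)$ is the space of compactly supported Lipschitz maps. $\lVert f\rVert_{L^1(\Omega;w)}=\int_\Omega|f|\,w\,dx$. $BV(\Omega;w)$ is the space of $f\in L^1(\Omega;w)$ (identified a.e.) such that $$\lVert Df\rVert_w(\Omega):=\sup\left\{\int_\Omega f\operatorname{div}\varphi\,dx:\varphi\in\mathrm{Lip}_c(\Omega;\mathbb{R}^n),\ |\varphi|\le w\right\}<\infty.$$ $\Omega_w$ is open in $\mathbb{R}^{n+1}$ because $w$ is lower semicontinuous. $BV(\Omega_w)$ is the classical space of $g\in L^1(\Omega_w)$ with $$\lVert Dg\rVert(\Omega_w):=\sup\left\{\int_{\Omega_w} g\operatorname{div}\varphi\,dz:\varphi\in\mathrm{Lip}_c(\Omega_w;\mathbb{R}^{n+1}),\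 |\varphi|\le1\right\}<\infty.$$ *)

theory Defs
  imports "HOL-Analysis.Analysis"
begin

definition lower_semicontinuous :: "('a::topological_space \<Rightarrow> 'b::order) \<Rightarrow> bool" where
  "lower_semicontinuous w \<longleftrightarrow> (\<forall>x a. a < w x \<longrightarrow> (\<forall>\<^sub>F y in nhds x. a < w y))"

(* A map on an open set U is represented by a total function; only its values on U matter.
   The closure below is taken in the whole space, so that the support is a compact set
   contained in U. *)
definition Lip_c :: "'a::euclidean_space set \<Rightarrow> ('a \<Rightarrow> 'b::euclidean_space) set" where
  "Lip_c U = {\<phi>. (\<exists>L. L-lipschitz_on U \<phi>) \<and>
                  compact (closure (support_on U \<phi>)) \<and> closure (support_on U \<phi>) \<subseteq> U}"

(* The sum of the partial derivatives of the components. For a Lipschitz map on an open set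
   these exist almost everywhere; where one of them does not exist, deriv has an unspecified
   value, which does not affect the integrals below. *)
definition divergence :: "('a::euclidean_space \<Rightarrow> 'a) \<Rightarrow> 'a \<Rightarrow> real" where
  "divergence \<phi> x = (\<Sum>b\<in>Basis. deriv (\<lambda>t. \<phi> (x + t *\<^sub>R b) \<bullet> b) 0)"

(* In ennreal, 0 * \<infinity> = 0, so f has to vanish almost everywhere on the set where w is infinite
   for the norm to be finite. *)
definition L1_norm :: "'a::euclidean_space set \<Rightarrow> ('a \<Rightarrow> ennreal) \<Rightarrow> ('a \<Rightarrow> real) \<Rightarrow> ennreal" where
  "L1_norm U w f = (\<integral>\<^sup>+x\<in>U. ennreal \<bar>f x\<bar> * w x \<partial>lebesgue)"

definition L1 :: "'a::euclidean_space set \<Rightarrow> ('a \<Rightarrow> ennreal) \<Rightarrow> ('a \<Rightarrow> real) set" where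
  "L1 U w = {f \<in> borel_measurable (lebesgue_on U). L1_norm U w f < \<infinity>}"

definition total_variation :: "'a::euclidean_space set \<Rightarrow> ('a \<Rightarrow> ennreal) \<Rightarrow> ('a \<Rightarrow> real) \<Rightarrow> ereal" where
  "total_variation U w f =
    (SUP \<phi>\<in>{\<phi>\<in>Lip_c U. \<forall>x\<in>U. ennreal (norm (\<phi> x)) \<le> w x}.
       ereal (LINT x:U|lebesgue. f x * divergence \<phi> x))"

(* The elements are representatives: two of them denote the same element of the space
   iff they agree almost everywhere on U. *)
definition BV :: "'a::euclidean_space set \<Rightarrow> ('a \<Rightarrow> ennreal) \<Rightarrow> ('a \<Rightarrow> real) set" where
  "BV U w = {f \<in> L1 U w. total_variation U w f < \<infinity>}"

(* The classical, unweighted spaces and norms are those with the weight 1. *)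
abbreviation unit_weight :: "'a \<Rightarrow> ennreal" where
  "unit_weight \<equiv> \<lambda>_. 1"

definition subgraph :: "'a set \<Rightarrow> ('a \<Rightarrow> ennreal) \<Rightarrow> ('a \<times> real) set" where
  "subgraph \<Omega> w = {(x, y). x \<in> \<Omega> \<and> 0 < y \<and> ennreal y < w x}"

definition J :: "('a \<Rightarrow> real) \<Rightarrow> 'a \<times> real \<Rightarrow> real" where
  "J f = (\<lambda>(x, y). f x)"

lemma L1_unit_weight:
  assumes "U \<in> sets lebesgue"
  shows "f \<in> L1 U unit_weight \<longleftrightarrow> set_integrable lebesgue U f"
proof -
  have "set_integrable lebesgue U f \<longleftrightarrow> integrable (lebesgue_on U) f"
    unfolding set_integrable_def using assms by (subst integrable_restrict_space) auto
  then show ?thesis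
    using assms unfolding L1_def L1_norm_def integrable_iff_bounded
    by (subst (asm) nn_integral_restrict_space) auto
qed

end

theory Submission
  imports Defs
begin

text \<open>Pushing a vector field on the subgraph down along the vertical lines turns the unweighted problem
into the weighted one. If \<open>\<psi>\<close> is a Lipschitz field with compact support in the subgraph and
\<open>\<bar>\<psi>\<bar> \<le> 1\<close>, let \<open>\<phi> x\<close> be the integral over \<open>y\<close> of the horizontal part of \<open>\<psi> (x, y)\<close>
(\<open>vertical_integral\<close>). Since the vertical section over \<open>x\<close> has length \<open>w x\<close>, the field \<open>\<phi>\<close>
satisfies \<open>\<bar>\<phi>\<bar> \<le> w\<close>; it is again Lipschitz with compact support. Differentiating under the integral
sign, and noting that the vertical derivative integrates to zero, shows that the divergence of \<open>\<phi>\<close> is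
the vertical integral of the divergence of \<open>\<psi>\<close> (\<open>divergence_vertical_integral\<close>). Because \<open>J f\<close> is
constant on vertical lines, Fubini's theorem gives equality of the integrals of \<open>J f * divergence \<psi>\<close>
and \<open>f * divergence \<phi>\<close> (\<open>integral_divergence_subgraph\<close>). So every competitor for the variation of
\<open>J f\<close> yields one for \<open>f\<close> with the same value.

Conversely, every \<open>\<phi>\<close> with \<open>\<bar>\<phi>\<bar> < w\<close> on its support is such a vertical integral
(\<open>vertical_integral_surjective\<close>): lower semicontinuity leaves a uniform gap between \<open>\<bar>\<phi>\<bar>\<close> and \<open>w\<close> on
the compact support, and in this gap there is room for a Lipschitz profile in \<open>y\<close> of height at most
\<open>1\<close> with the right integral. A general competitor is multiplied by a constant \<open>c < 1\<close>, and \<open>c\<close> tends to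
\<open>1\<close>. Together this gives \<open>total_variation_subgraph\<close>. The equality of the norms is Tonelli's theorem,
and injectivity is this equality applied to a difference.

The divergence of a Lipschitz field has an unspecified value where a partial derivative fails to
exist, so the exceptional set has to be null. This is the one-directional part of Rademacher's
theorem (\<open>lipschitz_AE_directional_derivative\<close>). On the real line, a Vitali covering argument shows
that a continuous monotone function has no difference quotients that oscillate between two values
on a set of positive measure; Tonelli's theorem and translation invariance carry this over to lines
in any direction.\<close>

section \<open>Secant slopes of continuous monotone functions\<close>

text \<open>The interval is recorded by its midpoint and its radius, the form in which Vitali's theorem delivers
its balls.\<close>

definition interval_around :: "real \<times> real \<Rightarrow> real set" where
  "interval_around i = {fst i - snd i..fst i + snd i}"

lemma interval_around_eq_cball: "interval_around i = cball (fst i) (snd i)"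
  by (simp add: interval_around_def cball_eq_atLeastAtMost)

lemma borel_interval_around [measurable, simp]: "interval_around i \<in> sets borel"
  by (simp add: interval_around_def)

text \<open>The Vitali covering theorem for balls does not ask that the points be the centres of the balls. The
interval between \<open>x\<close> and \<open>x + h\<close> is a ball that contains \<open>x\<close>, so one covering argument handles
difference quotients from the left and from the right.\<close>

lemma Vitali_covering_secants:
  fixes E W :: "real set"
  assumes "open W" "E \<subseteq> W"
    and freq: "\<And>x. x \<in> E \<Longrightarrow> \<exists>\<^sub>F h in at 0. P (min x (x + h)) (max x (x + h))"
  obtains C where "countable C"
    "\<And>i. i \<in> C \<Longrightarrow> 0 < snd i \<and> interval_around i \<subseteq> W \<and> P (fst i - snd i) (fst i + snd i)"
    "disjoint_family_on interval_around C"
    "negligible (E - \<Union>(interval_around ` C))"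
proof -
  define K where "K = {i. 0 < snd i \<and> interval_around i \<subseteq> W \<and> P (fst i - snd i) (fst i + snd i)}"
  have cov: "\<exists>i. i \<in> K \<and> x \<in> cball (fst i) (snd i) \<and> snd i < d" if x: "x \<in> E" and d: "0 < d" for x d
  proof -
    obtain e where e: "0 < e" "ball x e \<subseteq> W"
      using assms x by (meson openE subsetD)
    obtain h where h: "h \<noteq> 0" "\<bar>h\<bar> < min d e" "P (min x (x + h)) (max x (x + h))"
      using freq[OF x] d e unfolding frequently_at
      by (metis dist_real_def diff_zero min_less_iff_conj)
    define i where "i = (x + h / 2, \<bar>h\<bar> / 2)"
    have eq: "x + h/2 - \<bar>h\<bar>/2 = min x (x + h)" "x + h/2 + \<bar>h\<bar>/2 = max x (x + h)"
      by (auto simp: min_def max_def abs_if field_simps)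
    have "{min x (x+h)..max x (x+h)} \<subseteq> ball x e"
      using h by (auto simp: dist_real_def min_def max_def split: if_splits)
    then have "i \<in> K"
      using h e eq unfolding K_def i_def interval_around_def by auto
    moreover have "x \<in> cball (fst i) (snd i)" "snd i < d"
      using h by (auto simp: i_def dist_real_def)
    ultimately show ?thesis by blast
  qed
  have K0: "0 < snd i" if "i \<in> K" for i
    using that by (auto simp: K_def)
  obtain C where C: "countable C" "C \<subseteq> K"
     "pairwise (\<lambda>i j. disjnt (cball (fst i) (snd i)) (cball (fst j) (snd j))) C"
     "negligible (E - (\<Union>i \<in> C. cball (fst i) (snd i)))"
    by (rule Vitali_covering_theorem_cballs[where K = K and a = fst and r = snd and S = E, OF K0 cov])
  show thesis
  proof (rule that[of C])
    show "disjoint_family_on interval_around C"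
      using C(3) unfolding interval_around_eq_cball disjoint_family_on_def pairwise_def disjnt_def
      by blast
    show "negligible (E - \<Union>(interval_around ` C))"
      using C(4) unfolding interval_around_eq_cball .
    show "0 < snd i \<and> interval_around i \<subseteq> W \<and> P (fst i - snd i) (fst i + snd i)" if "i \<in> C" for i
      using subsetD[OF C(2) that] by (simp add: K_def)
  qed (fact C(1))
qed

lemma secant_slope_min_max:
  fixes G :: "real \<Rightarrow> real"
  assumes "h \<noteq> 0"
  shows "(G (x + h) - G x) / h = (G (max x (x + h)) - G (min x (x + h))) / (max x (x + h) - min x (x + h))"
proof (cases "h > 0")
  case False
  then have "max x (x + h) = x" "min x (x + h) = x + h"
    using assms by auto
  moreover have "(G (x + h) - G x) / h = (G x - G (x + h)) / (x - (x + h))"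
    using minus_divide_divide[of "G x - G (x + h)" h] by simp
  ultimately show ?thesis by simp
qed auto

lemma frequently_secant_slope:
  fixes G :: "real \<Rightarrow> real"
  assumes "\<exists>\<^sub>F h in at 0. R ((G (x + h) - G x) / h)"
  shows "\<exists>\<^sub>F h in at 0. min x (x + h) < max x (x + h) \<and>
    R ((G (max x (x + h)) - G (min x (x + h))) / (max x (x + h) - min x (x + h)))"
proof -
  have "\<exists>\<^sub>F h in at 0. R ((G (x + h) - G x) / h) \<and> h \<noteq> 0"
    using assms by (rule frequently_eventually_frequently) (rule eventually_neq_at_within)
  then show ?thesis
  proof (rule frequently_elim1)
    fix h assume h: "R ((G (x + h) - G x) / h) \<and> h \<noteq> 0"
    then have "min x (x + h) < max x (x + h)"
      by auto
    then show "min x (x + h) < max x (x + h) \<and>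
      R ((G (max x (x + h)) - G (min x (x + h))) / (max x (x + h) - min x (x + h)))"
      using h secant_slope_min_max[of h G x] by (simp only: not_False_eq_True simp_thms)
  qed
qed

lemma emeasure_disjoint_intervals:
  assumes "countable C" "disjoint_family_on interval_around C" "sets M = sets borel"
  shows "emeasure M (\<Union>(interval_around ` C)) = (\<integral>\<^sup>+i. emeasure M (interval_around i) \<partial>count_space C)"
  by (rule emeasure_UN_countable) (use assms in auto)

lemma emeasure_interval_around:
  assumes "0 < snd i"
  shows "emeasure lborel (interval_around i) = ennreal (2 * snd i)"
  using assms by (simp add: interval_around_def)

lemma interval_measure_interval_around:
  assumes "mono G" "continuous_on UNIV G" "0 < snd i"
  shows "emeasure (interval_measure G) (interval_around i) = ennreal (G (fst i + snd i) - G (fst i - snd i))"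
  unfolding interval_around_def
  by (rule emeasure_interval_measure_Icc) (use assms in \<open>auto simp: mono_def\<close>)

text \<open>On each interval with secant slope below \<open>p\<close> the measure of \<open>G\<close> is at most \<open>p\<close> times the length, and
a disjoint Vitali family of such intervals covers almost all of \<open>E\<close>. The open set \<open>U\<close> is the union of
the interiors; the endpoints, being countably many, do not matter. Openness of \<open>U\<close> allows a second
covering argument inside \<open>U\<close>.\<close>

lemma small_slopes_interval_measure_le:
  fixes G :: "real \<Rightarrow> real"
  assumes G: "mono G" "continuous_on UNIV G" and W: "open W" "E \<subseteq> W"
    and freq: "\<And>x. x \<in> E \<Longrightarrow> \<exists>\<^sub>F h in at 0. (G (x + h) - G x) / h < p"
  obtains U where "open U" "U \<subseteq> W" "negligible (E - U)"
    "emeasure (interval_measure G) U \<le> ennreal p * emeasure lborel W"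
proof -
  let ?M = "interval_measure G"
  define P where "P l r \<longleftrightarrow> l < r \<and> (G r - G l) / (r - l) < p" for l r
  have "\<exists>\<^sub>F h in at 0. P (min x (x + h)) (max x (x + h))" if "x \<in> E" for x
    using frequently_secant_slope[of "\<lambda>s. s < p", OF freq[OF that]] unfolding P_def .
  from Vitali_covering_secants[where P = P, OF W this]
  obtain C where C: "countable C"
    "\<And>i. i \<in> C \<Longrightarrow> 0 < snd i \<and> interval_around i \<subseteq> W \<and> P (fst i - snd i) (fst i + snd i)"
    "disjoint_family_on interval_around C"
    "negligible (E - \<Union>(interval_around ` C))"
    by blast
  define U where "U = (\<Union>i\<in>C. {fst i - snd i<..<fst i + snd i})"
  let ?V = "\<Union>(interval_around ` C)"
  have UV: "U \<subseteq> ?V"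
    unfolding U_def interval_around_def by (intro UN_mono) auto
  have VO: "?V \<subseteq> W"
    using C(2) by blast
  have bV: "?V \<in> sets borel"
    using C(1) by (intro sets.countable_UN') auto
  show thesis
  proof (rule that[of U])
    show "open U" unfolding U_def by (intro open_UN ballI open_greaterThanLessThan)
    show "U \<subseteq> W"
      using UV VO by simp
    have "countable (\<Union>i\<in>C. {fst i - snd i, fst i + snd i})"
      using C(1) by (intro countable_UN) auto
    then have "negligible (\<Union>i\<in>C. {fst i - snd i, fst i + snd i})"
      unfolding negligible_iff_null_sets
      by (intro null_sets_completionI countable_imp_null_set_lborel)
    then have "negligible ((E - ?V) \<union> (\<Union>i\<in>C. {fst i - snd i, fst i + snd i}))"
      using C(4) by (rule negligible_Un[rotated])
    moreover have "E - U \<subseteq> (E - ?V) \<union> (\<Union>i\<in>C. {fst i - snd i, fst i + snd i})"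
    proof
      fix x assume x: "x \<in> E - U"
      show "x \<in> (E - ?V) \<union> (\<Union>i\<in>C. {fst i - snd i, fst i + snd i})"
      proof (cases "x \<in> ?V")
        case True
        then obtain i where i: "i \<in> C" "fst i - snd i \<le> x" "x \<le> fst i + snd i"
          by (auto simp: interval_around_def)
        moreover have "\<not> (fst i - snd i < x \<and> x < fst i + snd i)"
          using x i(1) by (auto simp: U_def)
        ultimately have "x = fst i - snd i \<or> x = fst i + snd i"
          by linarith
        then show ?thesis using i(1) by blast
      qed (use x in blast)
    qed
    ultimately show "negligible (E - U)"
      by (rule negligible_subset)
    have "emeasure ?M U \<le> emeasure ?M ?V"
      using UV bV by (intro emeasure_mono) auto
    also have "\<dots> = (\<integral>\<^sup>+i. emeasure ?M (interval_around i) \<partial>count_space C)"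
      using C by (intro emeasure_disjoint_intervals) auto
    also have "\<dots> \<le> (\<integral>\<^sup>+i. ennreal p * emeasure lborel (interval_around i) \<partial>count_space C)"
    proof (rule nn_integral_mono)
      fix i assume "i \<in> space (count_space C)"
      then have s: "0 < snd i" and P: "P (fst i - snd i) (fst i + snd i)"
        using C(2)[of i] by simp_all
      have "G (fst i + snd i) - G (fst i - snd i) \<le> p * (2 * snd i)"
        using P s by (simp add: P_def field_simps)
      then have "emeasure ?M (interval_around i) \<le> ennreal (p * (2 * snd i))"
        using interval_measure_interval_around[OF G s] by (simp add: ennreal_leI)
      also have "\<dots> = ennreal p * ennreal (2 * snd i)"
        using s by (intro ennreal_mult'') simp
      finally show "emeasure ?M (interval_around i) \<le> ennreal p * emeasure lborel (interval_around i)"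
        using emeasure_interval_around[OF s] by simp
    qed
    also have "\<dots> = ennreal p * (\<integral>\<^sup>+i. emeasure lborel (interval_around i) \<partial>count_space C)"
      by (intro nn_integral_cmult) auto
    also have "(\<integral>\<^sup>+i. emeasure lborel (interval_around i) \<partial>count_space C) = emeasure lborel ?V"
      using C by (intro emeasure_disjoint_intervals[symmetric]) auto
    also have "ennreal p * \<dots> \<le> ennreal p * emeasure lborel W"
      using VO \<open>open W\<close> by (intro mult_left_mono emeasure_mono) auto
    finally show "emeasure ?M U \<le> ennreal p * emeasure lborel W" .
  qed
qed

text \<open>The counterpart for slopes above \<open>q\<close>, used inside the set \<open>U\<close> of the preceding lemma.\<close>

lemma large_slopes_interval_measure_ge:
  fixes G :: "real \<Rightarrow> real"
  assumes G: "mono G" "continuous_on UNIV G" and U: "open U" "S \<subseteq> U" and S: "S \<in> sets borel"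
    and freq: "\<And>x. x \<in> S \<Longrightarrow> \<exists>\<^sub>F h in at 0. q < (G (x + h) - G x) / h"
  shows "ennreal q * emeasure lborel S \<le> emeasure (interval_measure G) U"
proof -
  let ?M = "interval_measure G"
  define P where "P l r \<longleftrightarrow> l < r \<and> q < (G r - G l) / (r - l)" for l r
  have "\<exists>\<^sub>F h in at 0. P (min x (x + h)) (max x (x + h))" if "x \<in> S" for x
    using frequently_secant_slope[of "\<lambda>s. q < s", OF freq[OF that]] unfolding P_def .
  from Vitali_covering_secants[where P = P, OF U this]
  obtain C where C: "countable C"
    "\<And>i. i \<in> C \<Longrightarrow> 0 < snd i \<and> interval_around i \<subseteq> U \<and> P (fst i - snd i) (fst i + snd i)"
    "disjoint_family_on interval_around C"
    "negligible (S - \<Union>(interval_around ` C))"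
    by blast
  let ?V = "\<Union>(interval_around ` C)"
  have bV: "?V \<in> sets borel"
    using C(1) by (intro sets.countable_UN') auto
  have VU: "?V \<subseteq> U"
    using C(2) by blast
  have "S - ?V \<in> null_sets lborel"
    using C(4) bV S unfolding negligible_iff_null_sets null_sets_def by auto
  then have "emeasure lborel (?V \<union> (S - ?V)) = emeasure lborel ?V"
    using bV by (intro emeasure_Un_null_set) auto
  moreover have "emeasure lborel S \<le> emeasure lborel (?V \<union> (S - ?V))"
    using bV S by (intro emeasure_mono) auto
  ultimately have "ennreal q * emeasure lborel S \<le> ennreal q * emeasure lborel ?V"
    by (intro mult_left_mono) auto
  also have "emeasure lborel ?V = (\<integral>\<^sup>+i. emeasure lborel (interval_around i) \<partial>count_space C)"
    using C by (intro emeasure_disjoint_intervals) auto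
  also have "ennreal q * \<dots> = (\<integral>\<^sup>+i. ennreal q * emeasure lborel (interval_around i) \<partial>count_space C)"
    by (intro nn_integral_cmult[symmetric]) auto
  also have "\<dots> \<le> (\<integral>\<^sup>+i. emeasure ?M (interval_around i) \<partial>count_space C)"
  proof (rule nn_integral_mono)
    fix i assume "i \<in> space (count_space C)"
    then have s: "0 < snd i" and P: "P (fst i - snd i) (fst i + snd i)"
      using C(2)[of i] by simp_all
    have le: "q * (2 * snd i) \<le> G (fst i + snd i) - G (fst i - snd i)"
      using P s by (simp add: P_def field_simps)
    have "ennreal q * emeasure lborel (interval_around i) = ennreal (q * (2 * snd i))"
      unfolding emeasure_interval_around[OF s] using s by (intro ennreal_mult''[symmetric]) simp
    also have "\<dots> \<le> emeasure ?M (interval_around i)"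
      using interval_measure_interval_around[OF G s] le by (simp add: ennreal_leI)
    finally show "ennreal q * emeasure lborel (interval_around i) \<le> emeasure ?M (interval_around i)" .
  qed
  also have "\<dots> = emeasure ?M ?V"
    using C by (intro emeasure_disjoint_intervals[symmetric]) auto
  also have "\<dots> \<le> emeasure ?M U"
    using VU \<open>open U\<close> by (intro emeasure_mono) auto
  finally show ?thesis .
qed


text \<open>If \<open>E\<close> has measure \<open>m\<close> and \<open>T\<close> is an open superset of measure at most \<open>m + e\<close>, then the two covering
lemmas squeeze the measure of \<open>G\<close> on an open set between \<open>q * m\<close> and \<open>p * (m + e)\<close>. Since \<open>e\<close> is
arbitrary and \<open>p < q\<close>, this forces \<open>m = 0\<close>.\<close>

lemma mono_small_and_large_slopes_null:
  fixes G :: "real \<Rightarrow> real"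
  assumes G: "mono G" "continuous_on UNIV G" and pq: "0 < p" "p < q"
    and E: "E \<in> sets borel" "bounded E"
    and small: "\<And>x. x \<in> E \<Longrightarrow> \<exists>\<^sub>F h in at 0. (G (x + h) - G x) / h < p"
    and large: "\<And>x. x \<in> E \<Longrightarrow> \<exists>\<^sub>F h in at 0. q < (G (x + h) - G x) / h"
  shows "emeasure lborel E = 0"
proof -
  have fin: "emeasure lborel E < \<infinity>"
    using E(2) by (rule emeasure_bounded_finite)
  then obtain m where m: "emeasure lborel E = ennreal m" "0 \<le> m"
    by (cases "emeasure lborel E") auto
  have "(q - p) * m \<le> p * e" if e: "0 < e" for e
  proof -
    obtain T where T: "open T" "E \<subseteq> T" "emeasure lborel (T - E) < ennreal e"
      using outer_regular_lborel[OF E(1) e] by blast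
    have "emeasure lborel T = emeasure lborel (E \<union> (T - E))"
      using T(2) by (simp add: Un_absorb1)
    also have "\<dots> \<le> emeasure lborel E + emeasure lborel (T - E)"
      using E(1) T(1) by (intro emeasure_subadditive) auto
    also have "\<dots> \<le> ennreal m + ennreal e"
      using T(3) m by (intro add_mono) auto
    finally have T_le: "emeasure lborel T \<le> ennreal (m + e)"
      using m e by simp
    obtain U where U: "open U" "U \<subseteq> T" "negligible (E - U)"
      "emeasure (interval_measure G) U \<le> ennreal p * emeasure lborel T"
      by (rule small_slopes_interval_measure_le[OF G T(1,2) small])
    have "E - U \<in> null_sets lborel"
      using U(1,3) E(1) unfolding negligible_iff_null_sets null_sets_def by auto
    then have "emeasure lborel ((E \<inter> U) \<union> (E - U)) = emeasure lborel (E \<inter> U)"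
      using E(1) U(1) by (intro emeasure_Un_null_set) auto
    then have "emeasure lborel E = emeasure lborel (E \<inter> U)"
      by (simp add: Int_Diff_Un)
    moreover have "ennreal q * emeasure lborel (E \<inter> U) \<le> emeasure (interval_measure G) U"
      using E(1) U(1) by (intro large_slopes_interval_measure_ge[OF G] large) auto
    ultimately have "ennreal q * ennreal m \<le> ennreal p * emeasure lborel T"
      using U(4) m by simp
    also have "\<dots> \<le> ennreal p * ennreal (m + e)"
      using T_le by (intro mult_left_mono) auto
    finally have "q * m \<le> p * (m + e)"
      using m pq e by (simp add: ennreal_mult[symmetric] del: ennreal_plus)
    then show ?thesis by (simp add: algebra_simps)
  qed
  then have "(q - p) * m / p \<le> 0 + e" if "0 < e" for e
    using that pq by (simp add: field_simps)
  then have "(q - p) * m / p \<le> 0"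
    by (rule field_le_epsilon)
  then have "(q - p) * m \<le> 0"
    using pq by (simp add: divide_le_0_iff)
  then have "m = 0"
    using pq m by (simp add: mult_le_0_iff)
  then show ?thesis using m by simp
qed

section \<open>Directional derivatives of Lipschitz functions\<close>

lemma frequently_at_0_neq_cong:
  assumes "\<And>h::real. h \<noteq> 0 \<Longrightarrow> P h \<longleftrightarrow> Q h"
  shows "(\<exists>\<^sub>F h in at 0. P h) \<longleftrightarrow> (\<exists>\<^sub>F h in at 0. Q h)"
  unfolding frequently_at using assms by blast

text \<open>The set is a countable intersection of open sets: for each bound \<open>inverse (Suc n)\<close> on \<open>\<bar>t\<bar>\<close>, it is the
union over the admissible \<open>t\<close> of the open sets on which the slope at \<open>t\<close> is below \<open>p\<close>.\<close>

lemma borel_frequently_slope_less: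
  fixes u :: "'a::euclidean_space \<Rightarrow> real"
  assumes "continuous_on UNIV u"
  shows "{x. \<exists>\<^sub>F t in at 0. (u (x + t *\<^sub>R v) - u x) / t < p} \<in> sets borel"
proof -
  have "{x. \<exists>\<^sub>F t in at 0. (u (x + t *\<^sub>R v) - u x) / t < p} =
    (\<Inter>n::nat. \<Union>t\<in>{t. t \<noteq> 0 \<and> \<bar>t\<bar> < inverse (Suc n)}. {x. (u (x + t *\<^sub>R v) - u x) / t < p})"
    (is "?A = ?B")
  proof (intro set_eqI iffI)
    fix x assume "x \<in> ?A"
    then show "x \<in> ?B"
      unfolding frequently_at by (auto simp: dist_real_def)
  next
    fix x assume x: "x \<in> ?B"
    show "x \<in> ?A"
      unfolding frequently_at mem_Collect_eq
    proof (intro allI impI)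
      fix d :: real assume "0 < d"
      then obtain n :: nat where n: "inverse (Suc n) < d"
        using reals_Archimedean by blast
      obtain t where t: "t \<noteq> 0" "\<bar>t\<bar> < inverse (Suc n)" "(u (x + t *\<^sub>R v) - u x) / t < p"
        using x by blast
      then have "dist t 0 < d"
        using n by (simp add: dist_real_def)
      then show "\<exists>t\<in>UNIV. t \<noteq> 0 \<and> dist t 0 < d \<and> (u (x + t *\<^sub>R v) - u x) / t < p"
        using t by blast
    qed
  qed
  moreover have "open {x. (u (x + t *\<^sub>R v) - u x) / t < p}" if "t \<noteq> 0" for t
    using that
    by (intro open_Collect_less continuous_intros continuous_on_compose2[OF assms]) simp_all
  then have "open (\<Union>t\<in>{t. t \<noteq> 0 \<and> \<bar>t\<bar> < inverse (Suc n)}. {x. (u (x + t *\<^sub>R v) - u x) / t < p})" for n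
    by (intro open_UN) simp
  then have "?B \<in> sets borel"
    by (intro sets.countable_INT image_subsetI borel_open) simp_all
  ultimately show ?thesis
    by simp
qed

lemma borel_frequently_slope_greater:
  fixes u :: "'a::euclidean_space \<Rightarrow> real"
  assumes "continuous_on UNIV u"
  shows "{x. \<exists>\<^sub>F t in at 0. q < (u (x + t *\<^sub>R v) - u x) / t} \<in> sets borel"
proof -
  have "q < (u (x + t *\<^sub>R v) - u x) / t \<longleftrightarrow> (- u (x + t *\<^sub>R v) - - u x) / t < - q" for x t
    by (simp add: diff_divide_distrib) linarith
  then show ?thesis
    using borel_frequently_slope_less[of "\<lambda>x. - u x" v "- q"] assms
    by (simp add: continuous_on_minus)
qed

text \<open>At a point of this set the difference quotients along \<open>v\<close> oscillate: their lower limit is at most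
\<open>p\<close> and their upper limit at least \<open>q\<close>. For Lipschitz \<open>u\<close>, a point outside all these sets with
rational \<open>p < q\<close> has a derivative along \<open>v\<close>.\<close>

definition slope_gap :: "('a::euclidean_space \<Rightarrow> real) \<Rightarrow> 'a \<Rightarrow> real \<Rightarrow> real \<Rightarrow> 'a set" where
  "slope_gap u v p q = {x. \<exists>\<^sub>F t in at 0. (u (x + t *\<^sub>R v) - u x) / t < p} \<inter>
                       {x. \<exists>\<^sub>F t in at 0. q < (u (x + t *\<^sub>R v) - u x) / t}"

lemma borel_slope_gap:
  "continuous_on UNIV u \<Longrightarrow> slope_gap u v p q \<in> sets borel"
  unfolding slope_gap_def
  by (intro sets.Int borel_frequently_slope_less borel_frequently_slope_greater)

text \<open>Adding the linear function \<open>K * x\<close> with large \<open>K\<close> shifts all slopes by \<open>K\<close> and makes the function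
monotone, which reduces the claim to the monotone case.\<close>

lemma null_slope_gap_real:
  fixes g :: "real \<Rightarrow> real"
  assumes lip: "L-lipschitz_on UNIV g" and pq: "p < q"
  shows "slope_gap g 1 p q \<in> null_sets lborel"
proof -
  define K where "K = L + \<bar>p\<bar> + 1"
  define G where "G x = g x + K * x" for x
  have L: "0 \<le> L"
    using lip by (rule lipschitz_on_nonneg)
  have cg: "continuous_on UNIV g"
    using lip by (rule lipschitz_on_continuous_on)
  have cG: "continuous_on UNIV G"
    unfolding G_def by (intro continuous_intros cg)
  have mG: "mono G"
  proof (rule monoI)
    fix x y :: real assume xy: "x \<le> y"
    have "\<bar>g y - g x\<bar> \<le> L * \<bar>y - x\<bar>"
      using lipschitz_onD[OF lip, of y x] by (simp add: dist_real_def)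
    also have "\<dots> \<le> K * (y - x)"
      using xy L by (intro mult_mono) (auto simp: K_def)
    finally show "G x \<le> G y"
      by (simp add: G_def algebra_simps)
  qed
  have slope: "(G (x + h) - G x) / h = (g (x + h *\<^sub>R 1) - g x) / h + K" if "h \<noteq> 0" for x h
    using that by (simp add: G_def field_simps)
  have small: "(\<exists>\<^sub>F h in at 0. (g (x + h *\<^sub>R 1) - g x) / h < p) \<longleftrightarrow>
      (\<exists>\<^sub>F h in at 0. (G (x + h) - G x) / h < p + K)" for x
    by (rule frequently_at_0_neq_cong) (simp add: slope)
  have large: "(\<exists>\<^sub>F h in at 0. q < (g (x + h *\<^sub>R 1) - g x) / h) \<longleftrightarrow>
      (\<exists>\<^sub>F h in at 0. q + K < (G (x + h) - G x) / h)" for x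
    by (rule frequently_at_0_neq_cong) (simp add: slope)
  have "slope_gap g 1 p q \<inter> {-real n..real n} \<in> null_sets lborel" for n
  proof -
    have "emeasure lborel (slope_gap g 1 p q \<inter> {-real n..real n}) = 0"
    proof (rule mono_small_and_large_slopes_null[OF mG cG, of "p + K" "q + K"])
      show "slope_gap g 1 p q \<inter> {-real n..real n} \<in> sets borel"
        using borel_slope_gap[OF cg] by auto
      show "bounded (slope_gap g 1 p q \<inter> {-real n..real n})"
        by (simp add: bounded_Int)
      show "\<exists>\<^sub>F h in at 0. (G (x + h) - G x) / h < p + K"
        and "\<exists>\<^sub>F h in at 0. q + K < (G (x + h) - G x) / h"
        if "x \<in> slope_gap g 1 p q \<inter> {-real n..real n}" for x
        using that unfolding slope_gap_def small[symmetric] large[symmetric] by auto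
    qed (use pq L in \<open>auto simp: K_def\<close>)
    then show ?thesis
      using borel_slope_gap[OF cg] by (auto simp: null_sets_def)
  qed
  then have "(\<Union>n. slope_gap g 1 p q \<inter> {-real n..real n}) \<in> null_sets lborel"
    by blast
  moreover have "(\<Union>n. slope_gap g 1 p q \<inter> {-real n..real n}) = slope_gap g 1 p q"
  proof -
    have "\<exists>n. x \<in> {-real n..real n}" for x
      using real_arch_simple[of "\<bar>x\<bar>"] by (auto simp: abs_le_iff minus_le_iff)
    then show ?thesis by blast
  qed
  ultimately show ?thesis by simp
qed

lemma lborel_translate_nn_integral:
  fixes f :: "'a::euclidean_space \<Rightarrow> ennreal"
  assumes [measurable]: "f \<in> borel_measurable borel"
  shows "(\<integral>\<^sup>+x. f (x + c) \<partial>lborel) = (\<integral>\<^sup>+x. f x \<partial>lborel)"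
proof -
  have "(\<integral>\<^sup>+x. f x \<partial>lborel) = (\<integral>\<^sup>+x. f x \<partial>distr lborel borel ((+) c))"
    by (simp add: lborel_distr_plus)
  also have "\<dots> = (\<integral>\<^sup>+x. f (c + x) \<partial>lborel)"
    by (subst nn_integral_distr) auto
  finally show ?thesis by (simp add: add.commute)
qed

text \<open>By translation invariance, integrating the indicator of \<open>E\<close> at \<open>x + t *\<^sub>R v\<close> over \<open>x\<close> gives the
measure of \<open>E\<close> for every \<open>t\<close>; integrating over \<open>t\<close> first gives \<open>0\<close> by hypothesis. Tonelli's theorem
then says that \<open>\<infinity>\<close> times the measure of \<open>E\<close> is \<open>0\<close>. This works for every direction \<open>v\<close>, without a
splitting of the space into a line and a complement.\<close>

lemma null_set_if_null_on_lines:
  fixes E :: "'a::euclidean_space set"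
  assumes E [measurable]: "E \<in> sets borel"
    and null: "\<And>x. {t. x + t *\<^sub>R v \<in> E} \<in> null_sets lborel"
  shows "E \<in> null_sets lborel"
proof -
  have "(\<integral>\<^sup>+t. \<integral>\<^sup>+x. indicator E (x + t *\<^sub>R v) \<partial>lborel \<partial>(lborel :: real measure)) =
        (\<integral>\<^sup>+x. \<integral>\<^sup>+t. indicator E (x + t *\<^sub>R v) \<partial>(lborel :: real measure) \<partial>lborel)"
    by (rule lborel_pair.Fubini') simp
  moreover have "(\<integral>\<^sup>+t. indicator E (x + t *\<^sub>R v) \<partial>(lborel :: real measure)) = 0" for x
  proof -
    have "(\<integral>\<^sup>+t. indicator E (x + t *\<^sub>R v) \<partial>(lborel :: real measure)) =
          (\<integral>\<^sup>+t. indicator {t. x + t *\<^sub>R v \<in> E} t \<partial>lborel)"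
      by (intro nn_integral_cong) (simp add: indicator_def)
    also have "\<dots> = emeasure lborel {t. x + t *\<^sub>R v \<in> E}"
      using null[of x] by (intro nn_integral_indicator) auto
    finally show ?thesis using null[of x] by auto
  qed
  moreover have "(\<integral>\<^sup>+x. indicator E (x + t *\<^sub>R v) \<partial>lborel) = emeasure lborel E" for t
    by (subst lborel_translate_nn_integral) auto
  ultimately have "emeasure lborel E * emeasure lborel (UNIV :: real set) = 0"
    by simp
  then show ?thesis
    using E by (auto simp: null_sets_def)
qed

lemma lipschitz_on_line:
  fixes u :: "'a::euclidean_space \<Rightarrow> 'b::real_normed_vector"
  assumes "L-lipschitz_on UNIV u"
  shows "(L * norm v)-lipschitz_on UNIV (\<lambda>t. u (x + t *\<^sub>R v))"
proof (rule lipschitz_onI)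
  fix s t :: real
  have "dist (u (x + s *\<^sub>R v)) (u (x + t *\<^sub>R v)) \<le> L * dist (x + s *\<^sub>R v) (x + t *\<^sub>R v)"
    by (intro lipschitz_onD[OF assms]) auto
  also have "\<dots> = L * norm v * dist s t"
    by (simp add: dist_norm flip: scaleR_left_diff_distrib)
  finally show "dist (u (x + s *\<^sub>R v)) (u (x + t *\<^sub>R v)) \<le> L * norm v * dist s t" .
qed (use lipschitz_on_nonneg[OF assms] in auto)

lemma null_slope_gap:
  fixes u :: "'a::euclidean_space \<Rightarrow> real"
  assumes lip: "L-lipschitz_on UNIV u" and pq: "p < q"
  shows "slope_gap u v p q \<in> null_sets lborel"
proof (rule null_set_if_null_on_lines)
  show "slope_gap u v p q \<in> sets borel"
    using lip by (intro borel_slope_gap lipschitz_on_continuous_on)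
  fix x
  have "{t. x + t *\<^sub>R v \<in> slope_gap u v p q} = slope_gap (\<lambda>t. u (x + t *\<^sub>R v)) 1 p q"
    by (simp add: slope_gap_def scaleR_left_distrib add.assoc Collect_conj_eq)
  then show "{t. x + t *\<^sub>R v \<in> slope_gap u v p q} \<in> null_sets lborel"
    using null_slope_gap_real[OF lipschitz_on_line[OF lip] pq] by simp
qed

text \<open>The limit is the supremum of the eventual lower bounds of \<open>Q\<close>, that is, its lower limit. If \<open>Q\<close>
exceeded it frequently by a fixed amount, two rationals in between would form a gap.\<close>

lemma convergent_if_no_rational_gap:
  fixes Q :: "'a \<Rightarrow> real"
  assumes F: "F \<noteq> bot" and bdd: "\<And>t. \<bar>Q t\<bar> \<le> B"
    and gap: "\<And>p q. p \<in> \<rat> \<Longrightarrow> q \<in> \<rat> \<Longrightarrow> p < q \<Longrightarrow> \<not> ((\<exists>\<^sub>F t in F. Q t < p) \<and> (\<exists>\<^sub>F t in F. q < Q t))"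
  shows "\<exists>D. (Q \<longlongrightarrow> D) F"
proof -
  define A where "A = {r. \<forall>\<^sub>F t in F. r \<le> Q t}"
  have A0: "- B \<in> A"
    using bdd unfolding A_def by (auto simp: abs_le_iff minus_le_iff)
  have A1: "r \<le> B" if "r \<in> A" for r
  proof -
    have "\<forall>\<^sub>F t in F. r \<le> B"
      using that unfolding A_def mem_Collect_eq
      by (rule eventually_mono) (metis abs_le_D1 bdd order_trans)
    then show ?thesis using F by simp
  qed
  have bA: "bdd_above A"
    using A1 by (rule bdd_aboveI)
  have "(Q \<longlongrightarrow> Sup A) F"
  proof (rule order_tendstoI)
    fix a assume "a < Sup A"
    then obtain r where r: "r \<in> A" "a < r"
      using less_cSupE A0 by (metis empty_iff)
    then show "\<forall>\<^sub>F t in F. a < Q t"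
      unfolding A_def by (auto elim: eventually_mono)
  next
    fix b assume "Sup A < b"
    then obtain q where q: "q \<in> \<rat>" "Sup A < q" "q < b"
      using Rats_dense_in_real by blast
    then obtain p where p: "p \<in> \<rat>" "Sup A < p" "p < q"
      using Rats_dense_in_real by blast
    have "p \<notin> A"
      using p(2) cSup_upper[OF _ bA] by force
    then have "\<exists>\<^sub>F t in F. Q t < p"
      unfolding A_def by (simp add: not_eventually not_le)
    then have "\<not> (\<exists>\<^sub>F t in F. q < Q t)"
      using gap p q by blast
    then show "\<forall>\<^sub>F t in F. Q t < b"
      unfolding not_frequently using q(3) by (auto elim!: eventually_mono)
  qed
  then show ?thesis by blast
qed

text \<open>The part of Rademacher's theorem that the divergence requires: for each fixed direction, the
directional derivative exists almost everywhere.\<close>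

theorem lipschitz_AE_directional_derivative:
  fixes u :: "'a::euclidean_space \<Rightarrow> real"
  assumes lip: "L-lipschitz_on UNIV u"
  shows "AE x in lborel. \<exists>D. ((\<lambda>t. u (x + t *\<^sub>R v)) has_field_derivative D) (at 0)"
proof -
  have "AE x in lborel. \<forall>p\<in>\<rat>. \<forall>q\<in>\<rat>. p < q \<longrightarrow> x \<notin> slope_gap u v p q"
    using null_slope_gap[OF lip] by (intro AE_ball_countable' countable_rat AE_impI AE_not_in) 
  then show ?thesis
  proof (rule AE_mp, intro AE_I2 impI)
    fix x assume x: "\<forall>p\<in>\<rat>. \<forall>q\<in>\<rat>. p < q \<longrightarrow> x \<notin> slope_gap u v p q"
    define Q where "Q t = (u (x + t *\<^sub>R v) - u x) / t" for t
    have "\<bar>Q t\<bar> \<le> L * norm v" for t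
    proof (cases "t = 0")
      case True
      then show ?thesis using lipschitz_on_nonneg[OF lip] by (simp add: Q_def)
    next
      case False
      then show ?thesis
        using lipschitz_onD[OF lipschitz_on_line[OF lip, of v x], of t 0]
        by (simp add: Q_def dist_real_def field_simps abs_mult)
    qed
    then have "\<exists>D. (Q \<longlongrightarrow> D) (at 0)"
      using x by (intro convergent_if_no_rational_gap[of _ _ "L * norm v"])
        (auto simp: slope_gap_def Q_def)
    then show "\<exists>D. ((\<lambda>t. u (x + t *\<^sub>R v)) has_field_derivative D) (at 0)"
      unfolding DERIV_def Q_def by simp
  qed
qed

section \<open>Differentiation under the integral sign and the divergence\<close>

lemma borel_measurable_lebesgue_AE_limit:
  fixes s :: "nat \<Rightarrow> 'a::euclidean_space \<Rightarrow> real"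
  assumes [measurable]: "\<And>i. s i \<in> borel_measurable borel"
    and lim: "AE x in lborel. (\<lambda>i. s i x) \<longlonglongrightarrow> d x"
  shows "d \<in> borel_measurable lebesgue"
proof (rule borel_measurable_AE)
  have "(\<lambda>x. lim (\<lambda>i. s i x)) \<in> borel_measurable lborel"
    by simp
  then show "(\<lambda>x. lim (\<lambda>i. s i x)) \<in> borel_measurable lebesgue"
    by (rule measurable_completion)
  show "AE x in lebesgue. lim (\<lambda>i. s i x) = d x"
    using AE_completion[OF lim] by (rule AE_mp) (intro AE_I2 impI limI)
qed

text \<open>Lebesgue measure is complete, so almost everywhere equal functions are either both measurable or both
not measurable; in the second case both integrals have the default value \<open>0\<close>.\<close>

lemma integral_lebesgue_cong_AE:
  fixes f g :: "'a::euclidean_space \<Rightarrow> real"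
  assumes ae: "AE x in lborel. f x = g x"
  shows "integral\<^sup>L lebesgue f = integral\<^sup>L lebesgue g"
proof (cases "f \<in> borel_measurable lebesgue")
  case True
  moreover have "g \<in> borel_measurable lebesgue"
    using True AE_completion[OF ae] by (rule borel_measurable_AE)
  ultimately show ?thesis
    using AE_completion[OF ae] by (rule integral_cong_AE)
next
  case False
  have "AE x in lborel. g x = f x"
    using ae by (auto elim: AE_mp)
  then have "g \<notin> borel_measurable lebesgue"
    using False borel_measurable_AE[of g f] AE_completion by blast
  then have "\<not> integrable lebesgue f" "\<not> integrable lebesgue g"
    using False by blast+
  then show ?thesis
    by (simp add: not_integrable_integral_eq)
qed

lemma difference_quotients_tendsto:
  assumes "(f has_field_derivative D) (at (0::real))" "X \<longlonglongrightarrow> 0" "\<And>n. X n \<noteq> 0"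
  shows "(\<lambda>n. (f (X n) - f 0) / X n) \<longlonglongrightarrow> D"
proof -
  have "((\<lambda>h. (f (0 + h) - f 0) / h) \<longlongrightarrow> D) (at 0)"
    using assms(1) unfolding DERIV_def .
  then show ?thesis
    using assms(2,3) unfolding tendsto_at_iff_sequentially comp_def by auto
qed

text \<open>Differentiation under the integral sign. The difference quotients are dominated by
\<open>L * indicator {-R..R}\<close> and converge almost everywhere, so dominated convergence along sequences
\<open>X n \<longlonglongrightarrow> 0\<close> applies. In particular the integral is differentiable at \<open>0\<close> although the integrands
are so only for almost every \<open>y\<close>.\<close>

lemma has_derivative_integral_lipschitz:
  fixes G :: "real \<Rightarrow> real \<Rightarrow> real"
  assumes int: "\<And>t. integrable lborel (G t)"
    and bound: "\<And>t y. \<bar>t\<bar> \<le> 1 \<Longrightarrow> \<bar>G t y - G 0 y\<bar> \<le> L * \<bar>t\<bar> * indicator {-R..R} y"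
    and deriv: "AE y in lborel. \<exists>D. ((\<lambda>t. G t y) has_field_derivative D) (at 0)"
  shows "integrable lebesgue (\<lambda>y. deriv (\<lambda>t. G t y) 0)"
    and "((\<lambda>t. LINT y|lborel. G t y) has_field_derivative (LINT y|lebesgue. deriv (\<lambda>t. G t y) 0)) (at 0)"
proof -
  let ?d = "\<lambda>y. deriv (\<lambda>t. G t y) 0"
  have meas [measurable]: "G t \<in> borel_measurable borel" for t
    using int[of t] by simp
  have lim: "AE y in lborel. (\<lambda>n. (G (X n) y - G 0 y) / X n) \<longlonglongrightarrow> ?d y"
    if "X \<longlonglongrightarrow> 0" "\<And>n. X n \<noteq> 0" for X :: "nat \<Rightarrow> real"
    using deriv
  proof (rule AE_mp, intro AE_I2 impI)
    fix y assume "\<exists>D. ((\<lambda>t. G t y) has_field_derivative D) (at 0)"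
    then have "((\<lambda>t. G t y) has_field_derivative ?d y) (at 0)"
      using DERIV_imp_deriv by blast
    then show "(\<lambda>n. (G (X n) y - G 0 y) / X n) \<longlonglongrightarrow> ?d y"
      using that by (rule difference_quotients_tendsto)
  qed
  have "(\<lambda>n. inverse (real (Suc n))) \<longlonglongrightarrow> 0"
    by (rule LIMSEQ_inverse_real_of_nat)
  then have "AE y in lborel. (\<lambda>n. (G (inverse (real (Suc n))) y - G 0 y) / inverse (real (Suc n))) \<longlonglongrightarrow> ?d y"
    by (rule lim) simp
  then have d_meas: "?d \<in> borel_measurable lebesgue"
    by (rule borel_measurable_lebesgue_AE_limit[rotated]) simp
  have dom: "norm ((G t y - G 0 y) / t) \<le> L * indicator {-R..R} y" if "\<bar>t\<bar> \<le> 1" "t \<noteq> 0" for t y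
    using bound[OF that(1), of y] that(2) by (simp add: abs_divide divide_le_eq mult.assoc mult.commute mult.left_commute)
  have w_int: "integrable lebesgue (\<lambda>y. L * indicator {-R..R} y :: real)"
    by (intro integrable_mult_right integrable_real_indicator) (auto simp: emeasure_lborel_Icc_eq)
  have seq: "integrable lebesgue ?d \<and>
      (\<lambda>n. LINT y|lebesgue. (G (X n) y - G 0 y) / X n) \<longlonglongrightarrow> (LINT y|lebesgue. ?d y)"
    if X: "X \<longlonglongrightarrow> 0" "\<And>n. X n \<noteq> 0" "\<And>n. \<bar>X n\<bar> \<le> 1" for X :: "nat \<Rightarrow> real"
  proof (intro conjI)
    have m: "(\<lambda>y. (G (X n) y - G 0 y) / X n) \<in> borel_measurable lebesgue" for n
      by (rule measurable_completion) simp
    show "integrable lebesgue ?d"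
      by (rule integrable_dominated_convergence[OF d_meas m w_int AE_completion[OF lim[OF X(1,2)]]])
         (intro AE_I2 dom X)
    show "(\<lambda>n. LINT y|lebesgue. (G (X n) y - G 0 y) / X n) \<longlonglongrightarrow> (LINT y|lebesgue. ?d y)"
      by (rule integral_dominated_convergence[OF d_meas m w_int AE_completion[OF lim[OF X(1,2)]]])
         (intro AE_I2 dom X)
  qed
  show "integrable lebesgue ?d"
    using seq[OF LIMSEQ_inverse_real_of_nat] by (simp add: field_simps)
  have quot: "(LINT y|lebesgue. (G t y - G 0 y) / t) = ((LINT y|lborel. G t y) - (LINT y|lborel. G 0 y)) / t" for t
  proof -
    have "(LINT y|lebesgue. (G t y - G 0 y) / t) = (LINT y|lborel. (G t y - G 0 y) / t)"
      by (rule integral_completion) simp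
    then show ?thesis
      by (simp add: int)
  qed
  show "((\<lambda>t. LINT y|lborel. G t y) has_field_derivative (LINT y|lebesgue. ?d y)) (at 0)"
    unfolding DERIV_def tendsto_at_iff_sequentially
  proof (intro allI impI)
    fix X :: "nat \<Rightarrow> real" assume X: "\<forall>i. X i \<in> UNIV - {0}" "X \<longlonglongrightarrow> 0"
    then have "\<forall>\<^sub>F n in sequentially. \<bar>X n\<bar> < 1"
      using order_tendstoD(2)[OF tendsto_rabs_zero[OF X(2)], of 1] by simp
    then obtain N where N: "\<And>n. n \<ge> N \<Longrightarrow> \<bar>X n\<bar> < 1"
      unfolding eventually_sequentially by blast
    have "(\<lambda>n. LINT y|lebesgue. (G (X (n + N)) y - G 0 y) / X (n + N)) \<longlonglongrightarrow> (LINT y|lebesgue. ?d y)"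
      using seq[of "\<lambda>n. X (n + N)"] X N LIMSEQ_ignore_initial_segment[OF X(2), of N]
      by (simp add: less_imp_le)
    then have "(\<lambda>n. ((LINT y|lborel. G (X (n + N)) y) - (LINT y|lborel. G 0 y)) / X (n + N))
       \<longlonglongrightarrow> (LINT y|lebesgue. ?d y)"
      unfolding quot .
    then show "((\<lambda>h. ((LINT y|lborel. G (0 + h) y) - (LINT y|lborel. G 0 y)) / h) \<circ> X)
       \<longlonglongrightarrow> (LINT y|lebesgue. ?d y)"
      unfolding comp_def add_0 by (rule LIMSEQ_offset[where k = N])
  qed
qed

text \<open>This is differentiation under the integral sign for the translates of \<open>g\<close>: the integral of
\<open>g (y + t)\<close> does not depend on \<open>t\<close>.\<close>

lemma integral_deriv_compactly_supported:
  fixes g :: "real \<Rightarrow> real"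
  assumes lip: "L-lipschitz_on UNIV g" and supp: "\<And>y. \<bar>y\<bar> > R \<Longrightarrow> g y = 0"
    and deriv: "AE y in lborel. \<exists>D. ((\<lambda>t. g (y + t)) has_field_derivative D) (at 0)"
  shows "integrable lebesgue (\<lambda>y. deriv (\<lambda>t. g (y + t)) 0)"
    and "(LINT y|lebesgue. deriv (\<lambda>t. g (y + t)) 0) = 0"
proof -
  have cg: "continuous_on UNIV g"
    using lip by (rule lipschitz_on_continuous_on)
  then have [measurable]: "g \<in> borel_measurable borel"
    by (rule borel_measurable_continuous_onI)
  have "integrable lborel (\<lambda>y. indicator {-R..R} y *\<^sub>R g y)"
    by (rule borel_integrable_compact) (auto intro: continuous_on_subset[OF cg])
  also have "(\<lambda>y. indicator {-R..R} y *\<^sub>R g y) = g"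
  proof (rule ext)
    fix y show "indicator {-R..R} y *\<^sub>R g y = g y"
      using supp[of y] by (cases "y \<in> {-R..R}") auto
  qed
  finally have int_g: "integrable lborel g" .
  have int: "integrable lborel (\<lambda>y. g (y + t))" for t
    using lborel_integrable_real_affine[OF int_g, of 1 t] by (simp add: add.commute)
  have const: "(LINT y|lborel. g (y + t)) = (LINT y|lborel. g y)" for t
    using lborel_integral_real_affine[of 1 g t] by (simp add: add.commute)
  \<comment> \<open>The supports of all translates by \<open>\<bar>t\<bar> \<le> 1\<close> lie in \<open>{-(R + 1)..R + 1}\<close>.\<close>
  have bound: "\<bar>g (y + t) - g (y + 0)\<bar> \<le> L * \<bar>t\<bar> * indicator {-(R + 1)..R + 1} y" if t: "\<bar>t\<bar> \<le> 1" for t y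
  proof (cases "y \<in> {-(R + 1)..R + 1}")
    case True
    then show ?thesis
      using lipschitz_onD[OF lip, of "y + t" y] by (simp add: dist_real_def)
  next
    case False
    then have "\<bar>y\<bar> > R" "\<bar>y + t\<bar> > R"
      using t by auto
    then show ?thesis
      using supp[of y] supp[of "y + t"] False by simp
  qed
  note * = has_derivative_integral_lipschitz[of "\<lambda>t y. g (y + t)", OF int bound deriv]
  show "integrable lebesgue (\<lambda>y. deriv (\<lambda>t. g (y + t)) 0)"
    by (rule *(1))
  have "((\<lambda>t::real. LINT y|lborel. g y) has_field_derivative (LINT y|lebesgue. deriv (\<lambda>t. g (y + t)) 0)) (at 0)"
    using *(2) unfolding const .
  then show "(LINT y|lebesgue. deriv (\<lambda>t. g (y + t)) 0) = 0"
    using DERIV_const[of "LINT y|lborel. g y" "at 0"] DERIV_unique by blast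
qed

lemma divergence_cong_open:
  assumes "open U" "x \<in> U" "\<And>y. y \<in> U \<Longrightarrow> \<phi> y = \<psi> y"
  shows "divergence \<phi> x = divergence \<psi> x"
  unfolding divergence_def
proof (intro sum.cong refl deriv_cong_ev)
  fix b :: 'a
  have "open ((\<lambda>t. x + t *\<^sub>R b) -` U)"
    using assms(1) by (intro open_vimage continuous_intros)
  then have "\<forall>\<^sub>F t in nhds 0. t \<in> (\<lambda>t. x + t *\<^sub>R b) -` U"
    using assms(2) by (intro eventually_nhds_in_open) auto
  then show "\<forall>\<^sub>F t in nhds 0. \<phi> (x + t *\<^sub>R b) \<bullet> b = \<psi> (x + t *\<^sub>R b) \<bullet> b"
    by (rule eventually_mono) (simp add: assms(3))
qed

lemma divergence_eq_0_outside:
  assumes "closed K" "\<And>x. x \<notin> K \<Longrightarrow> \<phi> x = 0" "x \<notin> K"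
  shows "divergence \<phi> x = 0"
proof -
  have "divergence \<phi> x = divergence (\<lambda>_. 0) x"
    using assms by (intro divergence_cong_open[of "- K"]) auto
  then show ?thesis
    by (simp add: divergence_def)
qed

lemma lipschitz_on_inner:
  assumes "L-lipschitz_on X \<phi>" "norm b \<le> 1"
  shows "L-lipschitz_on X (\<lambda>x. \<phi> x \<bullet> b)"
proof (rule lipschitz_onI)
  fix x y assume "x \<in> X" "y \<in> X"
  have "dist (\<phi> x \<bullet> b) (\<phi> y \<bullet> b) = \<bar>(\<phi> x - \<phi> y) \<bullet> b\<bar>"
    by (simp add: dist_real_def inner_diff_left)
  also have "\<dots> \<le> norm (\<phi> x - \<phi> y) * norm b"
    by (rule Cauchy_Schwarz_ineq2)
  also have "\<dots> \<le> norm (\<phi> x - \<phi> y) * 1"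
    using assms(2) by (intro mult_left_mono) auto
  also have "\<dots> \<le> L * dist x y"
    using lipschitz_onD[OF assms(1) \<open>x \<in> X\<close> \<open>y \<in> X\<close>] by (simp add: dist_norm)
  finally show "dist (\<phi> x \<bullet> b) (\<phi> y \<bullet> b) \<le> L * dist x y" .
qed (rule lipschitz_on_nonneg[OF assms(1)])

lemma lipschitz_AE_partial_derivatives:
  fixes \<phi> :: "'a::euclidean_space \<Rightarrow> 'a"
  assumes "L-lipschitz_on UNIV \<phi>"
  shows "AE x in lborel. \<forall>b\<in>Basis. \<exists>D. ((\<lambda>t. \<phi> (x + t *\<^sub>R b) \<bullet> b) has_field_derivative D) (at 0)"
  by (intro AE_finite_allI finite_Basis lipschitz_AE_directional_derivative[OF lipschitz_on_inner[OF assms]])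
     simp

lemma lipschitz_divergence_bound:
  fixes \<phi> :: "'a::euclidean_space \<Rightarrow> 'a" and L :: real
  assumes lip: "L-lipschitz_on UNIV \<phi>"
    and ex: "\<forall>b\<in>Basis. \<exists>D. ((\<lambda>t. \<phi> (x + t *\<^sub>R b) \<bullet> b) has_field_derivative D) (at 0)"
  shows "\<bar>divergence \<phi> x\<bar> \<le> DIM('a) * L"
proof -
  have "\<bar>deriv (\<lambda>t. \<phi> (x + t *\<^sub>R b) \<bullet> b) 0\<bar> \<le> L" if b: "b \<in> Basis" for b
  proof -
    let ?u = "\<lambda>t. \<phi> (x + t *\<^sub>R b) \<bullet> b"
    have "(?u has_field_derivative deriv ?u 0) (at 0)"
      using ex b DERIV_imp_deriv by blast
    then have "(\<lambda>n. (?u (inverse (real (Suc n))) - ?u 0) / inverse (real (Suc n))) \<longlonglongrightarrow> deriv ?u 0"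
      by (rule difference_quotients_tendsto) (use LIMSEQ_inverse_real_of_nat in auto)
    then have lim: "(\<lambda>n. \<bar>(?u (inverse (real (Suc n))) - ?u 0) / inverse (real (Suc n))\<bar>) \<longlonglongrightarrow> \<bar>deriv ?u 0\<bar>"
      by (rule tendsto_rabs)
    have "\<bar>(?u t - ?u 0) / t\<bar> \<le> L" if "t > 0" for t
      using lipschitz_onD[OF lipschitz_on_line[OF lipschitz_on_inner[OF lip], of b b x], of t 0] b that
      by (simp add: dist_real_def field_simps)
    then show ?thesis
      by (intro LIMSEQ_le_const2[OF lim]) auto
  qed
  then have "\<bar>divergence \<phi> x\<bar> \<le> (\<Sum>b\<in>(Basis::'a set). L :: real)"
    unfolding divergence_def by (intro order_trans[OF sum_abs] sum_mono)
  then show ?thesis by simp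
qed

text \<open>The divergence is almost everywhere the limit of the continuous difference quotients along the
sequence \<open>inverse (Suc n)\<close>.\<close>

lemma borel_measurable_divergence:
  fixes \<phi> :: "'a::euclidean_space \<Rightarrow> 'a"
  assumes lip: "L-lipschitz_on UNIV \<phi>"
  shows "divergence \<phi> \<in> borel_measurable lebesgue"
proof (rule borel_measurable_lebesgue_AE_limit)
  let ?X = "\<lambda>n. inverse (real (Suc n))"
  let ?s = "\<lambda>n x. \<Sum>b\<in>Basis. (\<phi> (x + ?X n *\<^sub>R b) \<bullet> b - \<phi> (x + 0 *\<^sub>R b) \<bullet> b) / ?X n"
  have [measurable]: "\<phi> \<in> borel_measurable borel"
    using lip by (intro borel_measurable_continuous_onI lipschitz_on_continuous_on)
  show "?s n \<in> borel_measurable borel" for n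
    by measurable
  show "AE x in lborel. (\<lambda>n. ?s n x) \<longlonglongrightarrow> divergence \<phi> x"
    using lipschitz_AE_partial_derivatives[OF lip]
  proof (rule AE_mp, intro AE_I2 impI)
    fix x assume ex: "\<forall>b\<in>Basis. \<exists>D. ((\<lambda>t. \<phi> (x + t *\<^sub>R b) \<bullet> b) has_field_derivative D) (at 0)"
    show "(\<lambda>n. ?s n x) \<longlonglongrightarrow> divergence \<phi> x"
      unfolding divergence_def
    proof (intro tendsto_sum difference_quotients_tendsto)
      fix b :: 'a assume "b \<in> Basis"
      then show "((\<lambda>t. \<phi> (x + t *\<^sub>R b) \<bullet> b) has_field_derivative deriv (\<lambda>t. \<phi> (x + t *\<^sub>R b) \<bullet> b) 0) (at 0)"
        using ex DERIV_imp_deriv by blast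
    qed (use LIMSEQ_inverse_real_of_nat in auto)
  qed
qed

section \<open>The subgraph and the weighted norm\<close>

lemma open_lower_semicontinuous_greater:
  assumes "lower_semicontinuous w"
  shows "open {x. a < w x}"
proof (subst open_subopen, intro ballI)
  fix x assume "x \<in> {x. a < w x}"
  then have "\<forall>\<^sub>F y in nhds x. a < w y"
    using assms unfolding lower_semicontinuous_def by blast
  then show "\<exists>T. open T \<and> x \<in> T \<and> T \<subseteq> {x. a < w x}"
    unfolding eventually_nhds by blast
qed

lemma borel_measurable_lower_semicontinuous:
  fixes w :: "'a::topological_space \<Rightarrow> ennreal"
  assumes "lower_semicontinuous w"
  shows "w \<in> borel_measurable borel"
  by (rule borel_measurableI_greater) (simp add: borel_open open_lower_semicontinuous_greater[OF assms])

text \<open>All real \<open>y\<close> are allowed, also the negative ones, whose image in the extended nonnegative reals is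
\<open>0\<close>. In this form the lemma also provides the distance between a graph strictly below \<open>w\<close> and the
graph of \<open>w\<close>.\<close>

lemma open_below_lower_semicontinuous:
  fixes w :: "'a::topological_space \<Rightarrow> ennreal"
  assumes "lower_semicontinuous w"
  shows "open {(x, y). ennreal y < w x}"
proof (rule open_prod_intro)
  fix z assume "z \<in> {(x, y). ennreal y < w x}"
  then obtain x y where z: "z = (x, y)" "ennreal y < w x"
    by blast
  then obtain m where m: "ennreal y < m" "m < w x"
    using dense by blast
  have "open {y. ennreal y < m}"
    by (intro open_Collect_less continuous_on_ennreal continuous_intros)
  moreover have "{x. m < w x} \<times> {y. ennreal y < m} \<subseteq> {(x, y). ennreal y < w x}"
    by (auto intro: less_trans)
  ultimately show "\<exists>A B. open A \<and> open B \<and> z \<in> A \<times> B \<and> A \<times> B \<subseteq> {(x, y). ennreal y < w x}"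
    using m z open_lower_semicontinuous_greater[OF assms, of m]
    by (intro exI[of _ "{x. m < w x}"] exI[of _ "{y. ennreal y < m}"]) simp
qed

lemma open_subgraph:
  fixes w :: "'a::topological_space \<Rightarrow> ennreal"
  assumes "lower_semicontinuous w" "open \<Omega>"
  shows "open (subgraph \<Omega> w)"
proof -
  have "subgraph \<Omega> w = {(x, y). ennreal y < w x} \<inter> \<Omega> \<times> {0<..}"
    by (auto simp: subgraph_def)
  then show ?thesis
    using open_below_lower_semicontinuous[OF assms(1)] assms(2)
    by (simp add: open_Int open_Times)
qed

text \<open>The vertical section has length exactly \<open>w x\<close>, also when \<open>w x = \<infinity>\<close>. This identity is the source of
the isometry of the norms and of the constraint \<open>\<bar>\<phi>\<bar> \<le> w\<close> for vertical integrals.\<close>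

lemma emeasure_subgraph_section:
  "emeasure lborel {y. (x, y) \<in> subgraph \<Omega> w} = w x * indicator \<Omega> x"
proof (cases "x \<in> \<Omega>")
  case True
  then have sec: "{y. (x, y) \<in> subgraph \<Omega> w} = {y. 0 < y \<and> ennreal y < w x}"
    by (simp add: subgraph_def)
  have "emeasure lborel {y. 0 < y \<and> ennreal y < w x} = w x"
  proof (cases "w x")
    case (real r)
    then have "{y. 0 < y \<and> ennreal y < w x} = {0<..<r}"
      by (auto simp: ennreal_less_iff)
    then show ?thesis using real by simp
  next
    case top
    have le: "ennreal r \<le> emeasure lborel {0::real<..}" if "0 \<le> r" for r
    proof -
      have "emeasure lborel {0<..<r} \<le> emeasure lborel {0::real<..}"
        by (intro emeasure_mono) auto
      then show ?thesis using that by simp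
    qed
    have "emeasure lborel {0::real<..} = top"
    proof (cases "emeasure lborel {0::real<..}")
      case (real r)
      then show ?thesis using le[of "r + 1"] by simp
    qed
    then show ?thesis
      using top by (simp add: greaterThan_def)
  qed
  then show ?thesis using True sec by simp
next
  case False
  then show ?thesis by (simp add: subgraph_def)
qed

lemma AE_lborel_fst:
  assumes "AE x in (lborel :: 'a::euclidean_space measure). P x"
  shows "AE z in (lborel :: ('a \<times> 'b::euclidean_space) measure). P (fst z)"
proof -
  obtain N where N: "{x. \<not> P x} \<subseteq> N" "N \<in> null_sets lborel"
    using assms by (auto elim!: AE_E simp: null_sets_def)
  have "N \<times> UNIV \<in> null_sets (lborel \<Otimes>\<^sub>M (lborel :: 'b measure))"
    using N(2) by (intro lborel.times_in_null_sets1) auto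
  then have "N \<times> UNIV \<in> null_sets (lborel :: ('a \<times> 'b) measure)"
    by (simp add: lborel_prod)
  then show ?thesis
    by (rule AE_I') (use N(1) in auto)
qed

lemma AE_lborel_sections:
  assumes "AE z in (lborel :: ('a::euclidean_space \<times> 'b::euclidean_space) measure). P z"
  shows "AE x in lborel. AE y in lborel. P (x, y)"
proof (rule lborel_pair.AE_pair)
  show "AE z in lborel \<Otimes>\<^sub>M lborel. P z"
    unfolding lborel_prod by (rule assms)
qed

text \<open>A product of completed measures is not complete, so Fubini's theorem is applied to Borel functions: a
Lebesgue measurable \<open>f\<close> is replaced by a Borel function, and the zero extension outside \<open>\<Omega>\<close> makes it total.\<close>

lemma borel_representative:
  fixes f :: "'a::euclidean_space \<Rightarrow> real"
  assumes "f \<in> borel_measurable (lebesgue_on \<Omega>)" "open \<Omega>"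
  obtains f0 where "f0 \<in> borel_measurable borel" "AE x in lborel. indicator \<Omega> x * f x = f0 x"
proof -
  have "(\<lambda>x. indicator \<Omega> x * f x) \<in> borel_measurable lebesgue"
    using assms borel_measurable_restrict_space_iff[of \<Omega> lebesgue f] by simp
  then show thesis
    using completion_ex_borel_measurable_real that by fastforce
qed

lemma borel_measurable_fst:
  "fst \<in> borel_measurable (borel :: ('a::euclidean_space \<times> 'b::euclidean_space) measure)"
  by (intro borel_measurable_continuous_onI continuous_intros)

text \<open>Tonelli's theorem: the inner integral over the vertical section of \<open>x\<close> is \<open>\<bar>f x\<bar> * w x\<close>.\<close>

lemma L1_norm_subgraph:
  fixes f :: "'a::euclidean_space \<Rightarrow> real"
  assumes w: "lower_semicontinuous w" and \<Omega>: "open \<Omega>" and f: "f \<in> borel_measurable (lebesgue_on \<Omega>)"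
  shows "L1_norm (subgraph \<Omega> w) unit_weight (J f) = L1_norm \<Omega> w f"
proof -
  let ?S = "subgraph \<Omega> w"
  have [measurable]: "w \<in> borel_measurable borel" "\<Omega> \<in> sets borel" "?S \<in> sets borel"
    using w \<Omega> open_subgraph[OF w \<Omega>] by (auto intro: borel_measurable_lower_semicontinuous)
  obtain f0 where f0 [measurable]: "f0 \<in> borel_measurable borel"
    and ae: "AE x in lborel. indicator \<Omega> x * f x = f0 x"
    by (rule borel_representative[OF f \<Omega>])
  have "L1_norm ?S unit_weight (J f) = (\<integral>\<^sup>+z. ennreal \<bar>J f z\<bar> * indicator ?S z \<partial>lborel)"
    unfolding L1_norm_def by (simp add: nn_integral_completion)
  also have "\<dots> = (\<integral>\<^sup>+z. ennreal \<bar>f0 (fst z)\<bar> * indicator ?S z \<partial>lborel)"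
    by (rule nn_integral_cong_AE, rule AE_mp[OF AE_lborel_fst[OF ae]], intro AE_I2 impI)
       (auto simp: J_def indicator_def subgraph_def split: if_splits)
  also have "\<dots> = (\<integral>\<^sup>+z. ennreal \<bar>f0 (fst z)\<bar> * indicator ?S z \<partial>(lborel \<Otimes>\<^sub>M lborel))"
    by (simp add: lborel_prod)
  also have "\<dots> = (\<integral>\<^sup>+x. \<integral>\<^sup>+y. ennreal \<bar>f0 x\<bar> * indicator ?S (x, y) \<partial>lborel \<partial>lborel)"
  proof (subst lborel.nn_integral_fst[symmetric])
    note borel_measurable_fst [measurable]
    show "(\<lambda>z. ennreal \<bar>f0 (fst z)\<bar> * indicator ?S z) \<in> borel_measurable (lborel \<Otimes>\<^sub>M lborel)"
      unfolding lborel_prod by measurable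
  qed simp
  also have "\<dots> = (\<integral>\<^sup>+x. ennreal \<bar>f0 x\<bar> * w x * indicator \<Omega> x \<partial>lborel)"
  proof (intro nn_integral_cong)
    fix x
    have "open (Pair x -` ?S)"
      using open_subgraph[OF w \<Omega>] by (intro open_vimage continuous_intros)
    then have sec: "{y. (x, y) \<in> ?S} \<in> sets borel"
      by (simp add: vimage_def borel_open)
    have "(\<integral>\<^sup>+y. ennreal \<bar>f0 x\<bar> * indicator ?S (x, y) \<partial>lborel) =
          (\<integral>\<^sup>+y. ennreal \<bar>f0 x\<bar> * indicator {y. (x, y) \<in> ?S} y \<partial>lborel)"
      by (simp add: indicator_def)
    also have "\<dots> = ennreal \<bar>f0 x\<bar> * emeasure lborel {y. (x, y) \<in> ?S}"
      by (rule nn_integral_cmult_indicator) (simp add: sec)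
    finally show "(\<integral>\<^sup>+y. ennreal \<bar>f0 x\<bar> * indicator ?S (x, y) \<partial>lborel) = ennreal \<bar>f0 x\<bar> * w x * indicator \<Omega> x"
      by (simp add: emeasure_subgraph_section mult.assoc)
  qed
  also have "\<dots> = (\<integral>\<^sup>+x. ennreal \<bar>f x\<bar> * w x * indicator \<Omega> x \<partial>lborel)"
    by (rule nn_integral_cong_AE, rule AE_mp[OF ae], intro AE_I2 impI)
       (auto simp: indicator_def split: if_splits)
  also have "\<dots> = L1_norm \<Omega> w f"
    unfolding L1_norm_def by (simp add: nn_integral_completion)
  finally show ?thesis .
qed

lemma borel_measurable_J:
  fixes f :: "'a::euclidean_space \<Rightarrow> real"
  assumes w: "lower_semicontinuous w" and \<Omega>: "open \<Omega>" and f: "f \<in> borel_measurable (lebesgue_on \<Omega>)"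
  shows "J f \<in> borel_measurable (lebesgue_on (subgraph \<Omega> w))"
proof -
  let ?S = "subgraph \<Omega> w"
  have [measurable]: "?S \<in> sets borel"
    using open_subgraph[OF w \<Omega>] by auto
  obtain f0 where f0 [measurable]: "f0 \<in> borel_measurable borel"
    and ae: "AE x in lborel. indicator \<Omega> x * f x = f0 x"
    by (rule borel_representative[OF f \<Omega>])
  note borel_measurable_fst [measurable]
  have "(\<lambda>z. indicator ?S z * f0 (fst z)) \<in> borel_measurable lborel"
    by measurable
  then have "(\<lambda>z. indicator ?S z * f0 (fst z)) \<in> borel_measurable lebesgue"
    by (rule measurable_completion)
  moreover have "AE z in lebesgue. indicator ?S z * f0 (fst z) = indicator ?S z * J f z"
    using AE_lborel_fst[OF ae, THEN AE_completion]
    by (rule AE_mp, intro AE_I2 impI) (auto simp: J_def indicator_def subgraph_def split: if_splits)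
  ultimately have "(\<lambda>z. indicator ?S z * J f z) \<in> borel_measurable lebesgue"
    by (rule borel_measurable_AE)
  moreover have "?S \<inter> space lebesgue \<in> sets lebesgue"
    by simp
  ultimately show ?thesis
    by (simp add: borel_measurable_restrict_space_iff)
qed

text \<open>Apply the identity of norms to \<open>f - g\<close>: one norm vanishes if and only if the other does, and
a norm with a weight that vanishes nowhere detects equality almost everywhere.\<close>

lemma AE_J_eq_iff:
  fixes f g :: "'a::euclidean_space \<Rightarrow> real"
  assumes w: "lower_semicontinuous w" "\<forall>x. 0 < w x" and \<Omega>: "open \<Omega>"
    and f: "f \<in> borel_measurable (lebesgue_on \<Omega>)" and g: "g \<in> borel_measurable (lebesgue_on \<Omega>)"
  shows "(AE z in lebesgue_on (subgraph \<Omega> w). J f z = J g z) \<longleftrightarrow> (AE x in lebesgue_on \<Omega>. f x = g x)"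
proof -
  let ?S = "subgraph \<Omega> w" and ?h = "\<lambda>x. f x - g x"
  have h: "?h \<in> borel_measurable (lebesgue_on \<Omega>)"
    using f g by simp
  have w_meas: "w \<in> borel_measurable lebesgue"
    using borel_measurable_lower_semicontinuous[OF w(1)] by (intro measurable_completion) simp
  have zero_iff: "L1_norm U v u = 0 \<longleftrightarrow> (AE x in lebesgue_on U. u x = 0)"
    if "open U" and u: "u \<in> borel_measurable (lebesgue_on U)"
      and v: "v \<in> borel_measurable lebesgue" "\<And>x. v x \<noteq> 0"
    for U :: "'c::euclidean_space set" and v u
  proof -
    have "(\<integral>\<^sup>+x\<in>U. ennreal \<bar>u x\<bar> * v x \<partial>lebesgue) = (\<integral>\<^sup>+x. ennreal \<bar>u x\<bar> * v x \<partial>lebesgue_on U)"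
      using \<open>open U\<close> by (subst nn_integral_restrict_space) auto
    also have "\<dots> = 0 \<longleftrightarrow> (AE x in lebesgue_on U. ennreal \<bar>u x\<bar> * v x = 0)"
      using u measurable_restrict_space1[OF v(1)] by (intro nn_integral_0_iff_AE) simp
    finally show ?thesis
      using v(2) by (simp add: L1_norm_def)
  qed
  have "(AE z in lebesgue_on ?S. J f z = J g z) \<longleftrightarrow> (AE z in lebesgue_on ?S. J ?h z = 0)"
    by (simp add: J_def case_prod_unfold)
  also have "\<dots> \<longleftrightarrow> L1_norm ?S unit_weight (J ?h) = 0"
    by (rule zero_iff[symmetric]) (use open_subgraph[OF w(1) \<Omega>] borel_measurable_J[OF w(1) \<Omega> h] in auto)
  also have "\<dots> \<longleftrightarrow> L1_norm \<Omega> w ?h = 0"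
    by (simp add: L1_norm_subgraph[OF w(1) \<Omega> h])
  also have "\<dots> \<longleftrightarrow> (AE x in lebesgue_on \<Omega>. ?h x = 0)"
    by (rule zero_iff) (use \<Omega> h w_meas w(2) in \<open>auto simp: less_le\<close>)
  finally show ?thesis by simp
qed

section \<open>Compactly supported Lipschitz fields\<close>

lemma Lip_cI:
  assumes "L-lipschitz_on UNIV \<phi>" "compact K" "K \<subseteq> U" "\<And>x. x \<notin> K \<Longrightarrow> \<phi> x = 0"
  shows "\<phi> \<in> Lip_c U"
proof -
  have "support_on U \<phi> \<subseteq> K"
    using assms(4) by (auto simp: support_on_def)
  then have sub: "closure (support_on U \<phi>) \<subseteq> K"
    using assms(2) by (intro closure_minimal compact_imp_closed)
  then have "compact (closure (support_on U \<phi>))"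
    using assms(2) by (metis Int_absorb1 closed_closure compact_Int_closed)
  moreover have "L-lipschitz_on U \<phi>"
    using assms(1) by (rule lipschitz_on_subset) simp
  ultimately show ?thesis
    using sub assms(3) unfolding Lip_c_def by blast
qed

text \<open>Membership in \<open>Lip_c U\<close> constrains a map on \<open>U\<close> only. The extension by zero is Lipschitz with the same
constant: a segment from a point of the support to a point outside \<open>U\<close> is connected, so it cannot be
covered by the disjoint closed sets \<open>K\<close> and \<open>- U\<close>; at a point of \<open>U\<close> outside \<open>K\<close> the map vanishes.\<close>

lemma Lip_c_extend_by_zero:
  fixes \<phi> :: "'a::euclidean_space \<Rightarrow> 'b::euclidean_space"
  assumes U: "open U" and \<phi>: "\<phi> \<in> Lip_c U"
  obtains L \<phi>' K where "L-lipschitz_on UNIV \<phi>'" "compact K" "K \<subseteq> U"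
    "\<And>x. x \<notin> K \<Longrightarrow> \<phi>' x = 0" "\<And>x. x \<in> U \<Longrightarrow> \<phi>' x = \<phi> x"
proof -
  define K where "K = closure (support_on U \<phi>)"
  obtain L where L: "L-lipschitz_on U \<phi>" and K: "compact K" "K \<subseteq> U"
    using \<phi> unfolding Lip_c_def K_def by blast
  define \<phi>' where "\<phi>' x = (if x \<in> K then \<phi> x else 0)" for x
  have out: "\<phi>' x = 0" if "x \<notin> K" for x
    using that by (simp add: \<phi>'_def)
  have eq: "\<phi>' x = \<phi> x" if "x \<in> U" for x
  proof (cases "x \<in> K")
    case False
    then have "x \<notin> support_on U \<phi>"
      unfolding K_def using closure_subset by blast
    then show ?thesis
      using that False by (simp add: \<phi>'_def support_on_def)
  qed (simp add: \<phi>'_def)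
  have crossing: "norm (\<phi> x) \<le> L * dist x y" if x: "x \<in> U" and y: "y \<notin> U" for x y
  proof (cases "x \<in> K")
    case True
    have "\<exists>p. p \<in> closed_segment x y \<and> p \<in> U \<and> p \<notin> K"
    proof (rule ccontr)
      assume "\<not> ?thesis"
      then have "closed_segment x y \<subseteq> K \<union> - U"
        by blast
      moreover have "K \<inter> (- U) \<inter> closed_segment x y = {}"
        using K(2) by blast
      moreover have "closed K" "closed (- U)"
        using K(1) U by (auto intro: compact_imp_closed)
      ultimately have "K \<inter> closed_segment x y = {} \<or> - U \<inter> closed_segment x y = {}"
        using connected_closedD[OF connected_segment(1)] by blast
      then show False
        using True y by auto
    qed
    then obtain p where p: "p \<in> closed_segment x y" "p \<in> U" "p \<notin> K"
      by blast
    then have "\<phi> p = 0"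
      using eq[of p] out[of p] by simp
    then have "norm (\<phi> x) \<le> L * dist x p"
      using lipschitz_onD[OF L x p(2)] by simp
    also have "\<dots> \<le> L * dist x y"
      using p(1) lipschitz_on_nonneg[OF L]
      by (intro mult_left_mono) (metis dist_commute dist_in_closed_segment)
    finally show ?thesis .
  next
    case False
    then have "\<phi> x = 0"
      using eq[OF x] out[of x] by simp
    then show ?thesis
      using lipschitz_on_nonneg[OF L] by simp
  qed
  have "L-lipschitz_on UNIV \<phi>'"
  proof (rule lipschitz_onI)
    fix x y
    have *: "\<phi>' z = 0" if "z \<notin> U" for z
      using that K(2) by (intro out) blast
    show "dist (\<phi>' x) (\<phi>' y) \<le> L * dist x y"
    proof (cases "x \<in> U"; cases "y \<in> U")
      assume "x \<in> U" "y \<in> U"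
      then show ?thesis
        using lipschitz_onD[OF L] by (simp add: eq)
    next
      assume "x \<in> U" "y \<notin> U"
      then show ?thesis
        using crossing by (simp add: eq *)
    next
      assume "x \<notin> U" "y \<in> U"
      then show ?thesis
        using crossing[of y x] by (simp add: eq * dist_commute)
    next
      assume "x \<notin> U" "y \<notin> U"
      then show ?thesis
        using lipschitz_on_nonneg[OF L] by (simp add: *)
    qed
  qed (rule lipschitz_on_nonneg[OF L])
  then show thesis
    using K out eq by (rule that)
qed

text \<open>The competitors may be taken to be Lipschitz on the whole space and to vanish outside a compact
subset of \<open>U\<close>, since the divergence on the open set \<open>U\<close> depends only on the values in \<open>U\<close>.\<close>

lemma total_variation_eq_SUP_global:
  fixes U :: "'a::euclidean_space set"
  assumes U: "open U"
  shows "total_variation U v f =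
    (SUP \<phi>\<in>{\<phi>. \<exists>L K. L-lipschitz_on UNIV \<phi> \<and> compact K \<and> K \<subseteq> U \<and> (\<forall>x. x \<notin> K \<longrightarrow> \<phi> x = 0) \<and>
                    (\<forall>x\<in>U. ennreal (norm (\<phi> x)) \<le> v x)}.
       ereal (LINT x:U|lebesgue. f x * divergence \<phi> x))" (is "_ = (SUP \<phi>\<in>?A. ?I \<phi>)")
  unfolding total_variation_def
proof (rule SUP_eq)
  fix \<phi> :: "'a \<Rightarrow> 'a" assume "\<phi> \<in> {\<phi> \<in> Lip_c U. \<forall>x\<in>U. ennreal (norm (\<phi> x)) \<le> v x}"
  then have \<phi>: "\<phi> \<in> Lip_c U" "\<forall>x\<in>U. ennreal (norm (\<phi> x)) \<le> v x"
    by auto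
  obtain L \<phi>' K where \<phi>': "L-lipschitz_on UNIV \<phi>'" "compact K" "K \<subseteq> U"
    "\<And>x. x \<notin> K \<Longrightarrow> \<phi>' x = 0" "\<And>x. x \<in> U \<Longrightarrow> \<phi>' x = \<phi> x"
    by (rule Lip_c_extend_by_zero[OF U \<phi>(1)]) (rule that, assumption, assumption, assumption, blast+)
  have "?I \<phi> = ?I \<phi>'"
    unfolding set_lebesgue_integral_def
    using divergence_cong_open[OF U, of _ \<phi>' \<phi>] \<phi>'(5)
    by (auto intro!: Bochner_Integration.integral_cong simp: indicator_def)
  moreover have "\<phi>' \<in> ?A"
    using \<phi>' \<phi>(2) by auto
  ultimately show "\<exists>\<phi>'\<in>?A. ?I \<phi> \<le> ?I \<phi>'"
    by (intro bexI[of _ \<phi>']) simp_all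
next
  fix \<phi> :: "'a \<Rightarrow> 'a" assume "\<phi> \<in> ?A"
  then show "\<exists>\<phi>'\<in>{\<phi> \<in> Lip_c U. \<forall>x\<in>U. ennreal (norm (\<phi> x)) \<le> v x}. ?I \<phi> \<le> ?I \<phi>'"
    by (intro bexI[of _ \<phi>]) (auto intro: Lip_cI)
qed

section \<open>Integration along vertical lines\<close>

definition vertical_integral :: "('a::euclidean_space \<times> real \<Rightarrow> 'a \<times> real) \<Rightarrow> 'a \<Rightarrow> 'a" where
  "vertical_integral \<psi> x = (LINT y|lborel. fst (\<psi> (x, y)))"

lemma divergence_prod:
  fixes \<psi> :: "'a::euclidean_space \<times> real \<Rightarrow> 'a \<times> real"
  shows "divergence \<psi> (x, y) =
    (\<Sum>b\<in>Basis. deriv (\<lambda>t. fst (\<psi> (x + t *\<^sub>R b, y)) \<bullet> b) 0) + deriv (\<lambda>t. snd (\<psi> (x, y + t)) ) 0"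
proof -
  have "(\<Sum>b\<in>Basis. h b) = (\<Sum>b\<in>Basis. h (b, 0)) + h (0, 1)" for h :: "'a \<times> real \<Rightarrow> real"
  proof -
    have "(\<Sum>b\<in>(Basis :: ('a \<times> real) set). h b) =
          (\<Sum>b\<in>(\<lambda>u. (u, 0)) ` Basis. h b) + (\<Sum>b\<in>(\<lambda>v. (0, v)) ` Basis. h b)"
      unfolding Basis_prod_def by (intro sum.union_disjoint) auto
    then show ?thesis
      by (simp add: sum.reindex inj_on_def)
  qed
  then show ?thesis
    by (simp add: divergence_def inner_prod_def)
qed

lemma compact_support_vertical_bound:
  fixes K :: "('a::euclidean_space \<times> real) set"
  assumes "compact K"
  obtains R where "0 \<le> R" "\<And>x y. R < \<bar>y\<bar> \<Longrightarrow> (x, y) \<notin> K"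
proof -
  obtain R where R: "\<And>z. z \<in> K \<Longrightarrow> norm z \<le> R"
    using compact_imp_bounded[OF assms] unfolding bounded_iff by blast
  have "(x, y) \<notin> K" if "\<bar>R\<bar> < \<bar>y\<bar>" for x y
    using R[of "(x, y)"] norm_snd_le[of y x] that by auto
  then show thesis
    by (intro that[of "\<bar>R\<bar>"]) auto
qed

lemma continuous_vertical_integrable:
  fixes \<psi> :: "'a::euclidean_space \<times> real \<Rightarrow> 'b::euclidean_space"
  assumes cont: "continuous_on UNIV \<psi>" and R: "\<And>y. R < \<bar>y\<bar> \<Longrightarrow> \<psi> (x, y) = 0"
  shows "integrable lborel (\<lambda>y. \<psi> (x, y))"
proof -
  have "integrable lborel (\<lambda>y. indicator {-R..R} y *\<^sub>R \<psi> (x, y))"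
    by (rule borel_integrable_compact) (auto intro!: continuous_on_compose2[OF cont] continuous_intros)
  also have "(\<lambda>y. indicator {-R..R} y *\<^sub>R \<psi> (x, y)) = (\<lambda>y. \<psi> (x, y))"
  proof (rule ext)
    fix y show "indicator {-R..R} y *\<^sub>R \<psi> (x, y) = \<psi> (x, y)"
      using R[of y] by (cases "y \<in> {-R..R}") auto
  qed
  finally show ?thesis .
qed

lemma lipschitz_fst_increment:
  fixes \<psi> :: "'a::euclidean_space \<times> real \<Rightarrow> 'a \<times> real"
  assumes lip: "L-lipschitz_on UNIV \<psi>" and R: "\<And>x y. R < \<bar>y\<bar> \<Longrightarrow> \<psi> (x, y) = 0"
  shows "norm (fst (\<psi> (x, y)) - fst (\<psi> (x', y))) \<le> L * norm (x - x') * indicator {-R..R} y"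
proof (cases "y \<in> {-R..R}")
  case True
  have "norm (fst (\<psi> (x, y)) - fst (\<psi> (x', y))) \<le> norm (\<psi> (x, y) - \<psi> (x', y))"
    using norm_fst_le[of "fst (\<psi> (x, y) - \<psi> (x', y))" "snd (\<psi> (x, y) - \<psi> (x', y))"]
    unfolding prod.collapse by simp
  also have "\<dots> \<le> L * dist (x, y) (x', y)"
    using lipschitz_onD[OF lip, of "(x, y)" "(x', y)"] by (simp add: dist_norm)
  finally show ?thesis
    using True by (simp add: dist_Pair_Pair dist_norm)
next
  case False
  then have "R < \<bar>y\<bar>"
    by auto
  then show ?thesis
    using False by (simp add: R)
qed

lemma vertical_integral_lipschitz:
  fixes \<psi> :: "'a::euclidean_space \<times> real \<Rightarrow> 'a \<times> real"
  assumes lip: "L-lipschitz_on UNIV \<psi>" and R: "0 \<le> R" "\<And>x y. R < \<bar>y\<bar> \<Longrightarrow> \<psi> (x, y) = 0"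
  shows "(L * (2 * R))-lipschitz_on UNIV (vertical_integral \<psi>)"
proof (rule lipschitz_onI)
  fix x x' :: 'a
  have int: "integrable lborel (\<lambda>y. fst (\<psi> (x, y)))" for x
    using continuous_vertical_integrable[OF lipschitz_on_continuous_on[OF lip] R(2)] by (rule integrable_fst)
  have "dist (vertical_integral \<psi> x) (vertical_integral \<psi> x') =
        norm (LINT y|lborel. fst (\<psi> (x, y)) - fst (\<psi> (x', y)))"
    by (simp add: vertical_integral_def dist_norm int)
  also have "\<dots> \<le> (LINT y|lborel. L * norm (x - x') * indicator {-R..R} y)"
  proof (rule Bochner_Integration.integral_norm_bound_integral)
    show "integrable lborel (\<lambda>y. L * norm (x - x') * indicator {-R..R} y :: real)"
      by (intro integrable_mult_right integrable_real_indicator) (auto simp: emeasure_lborel_Icc_eq)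
  qed (use int lipschitz_fst_increment[OF lip R(2)] in auto)
  also have "\<dots> = L * (2 * R) * dist x x'"
    using R(1) by (simp add: dist_norm)
  finally show "dist (vertical_integral \<psi> x) (vertical_integral \<psi> x') \<le> L * (2 * R) * dist x x'" .
qed (use lipschitz_on_nonneg[OF lip] R(1) in simp)

lemma vertical_integral_eq_0:
  assumes "\<And>z. z \<notin> K \<Longrightarrow> \<psi> z = 0" "x \<notin> fst ` K"
  shows "vertical_integral \<psi> x = 0"
proof -
  have "\<psi> (x, y) = 0" for y
    using assms by force
  then show ?thesis
    by (simp add: vertical_integral_def)
qed

text \<open>The integrand has norm at most \<open>1\<close> and lives on the section of the subgraph, whose length is \<open>w x\<close>.\<close>

lemma norm_vertical_integral_le:
  fixes \<psi> :: "'a::euclidean_space \<times> real \<Rightarrow> 'a \<times> real"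
  assumes cont: "continuous_on UNIV \<psi>" and S: "open (subgraph \<Omega> w)"
    and K: "compact K" "K \<subseteq> subgraph \<Omega> w" "\<And>z. z \<notin> K \<Longrightarrow> \<psi> z = 0"
    and bound: "\<And>z. z \<in> subgraph \<Omega> w \<Longrightarrow> norm (\<psi> z) \<le> 1"
  shows "ennreal (norm (vertical_integral \<psi> x)) \<le> w x"
proof -
  let ?S = "subgraph \<Omega> w"
  obtain R where "0 \<le> R" and R: "\<And>x y. R < \<bar>y\<bar> \<Longrightarrow> (x, y) \<notin> K"
    by (rule compact_support_vertical_bound[OF K(1)]) (rule that; blast)
  have int: "integrable lborel (\<lambda>y. fst (\<psi> (x, y)))"
    using continuous_vertical_integrable[OF cont K(3)[OF R]] by (rule integrable_fst)
  have "open (Pair x -` ?S)"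
    using S by (intro open_vimage continuous_intros)
  then have sec: "{y. (x, y) \<in> ?S} \<in> sets borel"
    by (simp add: vimage_def borel_open)
  have "ennreal (norm (vertical_integral \<psi> x)) \<le> (\<integral>\<^sup>+y. ennreal (norm (fst (\<psi> (x, y)))) \<partial>lborel)"
    unfolding vertical_integral_def by (rule integral_norm_bound_ennreal[OF int])
  also have "\<dots> \<le> (\<integral>\<^sup>+y. indicator {y. (x, y) \<in> ?S} y \<partial>lborel)"
  proof (rule nn_integral_mono)
    fix y
    show "ennreal (norm (fst (\<psi> (x, y)))) \<le> indicator {y. (x, y) \<in> ?S} y"
    proof (cases "(x, y) \<in> ?S")
      case True
      have "norm (fst (\<psi> (x, y))) \<le> norm (\<psi> (x, y))"
        using norm_fst_le[of "fst (\<psi> (x, y))" "snd (\<psi> (x, y))"] by simp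
      then show ?thesis
        using True bound[OF True] by (simp add: ennreal_le_1)
    next
      case False
      then have "\<psi> (x, y) = 0"
        using K(2,3) by blast
      then show ?thesis by simp
    qed
  qed
  also have "\<dots> = emeasure lborel {y. (x, y) \<in> ?S}"
    using sec by (intro nn_integral_indicator) simp
  also have "\<dots> \<le> w x"
    by (simp add: emeasure_subgraph_section indicator_def)
  finally show ?thesis .
qed

text \<open>For the horizontal directions this is differentiation under the integral sign. The vertical part of
the divergence integrates to \<open>0\<close>, since the last component of \<open>\<psi>\<close> has compact support on the line
over \<open>x\<close>.\<close>

lemma divergence_vertical_integral:
  fixes \<psi> :: "'a::euclidean_space \<times> real \<Rightarrow> 'a \<times> real"
  assumes lip: "L-lipschitz_on UNIV \<psi>" and R: "\<And>x y. R < \<bar>y\<bar> \<Longrightarrow> \<psi> (x, y) = 0"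
    and ex: "AE y in lborel. \<forall>b\<in>Basis. \<exists>D. ((\<lambda>t. \<psi> ((x, y) + t *\<^sub>R b) \<bullet> b) has_field_derivative D) (at 0)"
  shows "divergence (vertical_integral \<psi>) x = (LINT y|lebesgue. divergence \<psi> (x, y))"
proof -
  have int: "integrable lborel (\<lambda>y. fst (\<psi> (x, y)))" for x
    using continuous_vertical_integrable[OF lipschitz_on_continuous_on[OF lip] R] by (rule integrable_fst)
  have hor: "integrable lebesgue (\<lambda>y. deriv (\<lambda>t. fst (\<psi> (x + t *\<^sub>R b, y)) \<bullet> b) 0) \<and>
      deriv (\<lambda>t. vertical_integral \<psi> (x + t *\<^sub>R b) \<bullet> b) 0 =
      (LINT y|lebesgue. deriv (\<lambda>t. fst (\<psi> (x + t *\<^sub>R b, y)) \<bullet> b) 0)" if b: "b \<in> Basis" for b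
  proof -
    let ?G = "\<lambda>t y. fst (\<psi> (x + t *\<^sub>R b, y)) \<bullet> b"
    have 1: "integrable lborel (?G t)" for t
      by (intro integrable_inner_left int)
    have 2: "\<bar>?G t y - ?G 0 y\<bar> \<le> L * \<bar>t\<bar> * indicator {-R..R} y" for t y
    proof -
      have "\<bar>?G t y - ?G 0 y\<bar> \<le> norm (fst (\<psi> (x + t *\<^sub>R b, y)) - fst (\<psi> (x, y)))"
        using Basis_le_norm[OF b, of "fst (\<psi> (x + t *\<^sub>R b, y)) - fst (\<psi> (x, y))"]
        by (simp add: inner_diff_left)
      also have "\<dots> \<le> L * norm (x + t *\<^sub>R b - x) * indicator {-R..R} y"
        by (rule lipschitz_fst_increment[OF lip R])
      finally show ?thesis
        using b by simp
    qed
    have 3: "AE y in lborel. \<exists>D. ((\<lambda>t. ?G t y) has_field_derivative D) (at 0)"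
      using ex
    proof (rule AE_mp, intro AE_I2 impI)
      fix y assume "\<forall>b\<in>Basis. \<exists>D. ((\<lambda>t. \<psi> ((x, y) + t *\<^sub>R b) \<bullet> b) has_field_derivative D) (at 0)"
      moreover have "(b, 0) \<in> (Basis :: ('a \<times> real) set)"
        using b by (simp add: Basis_prod_def)
      ultimately have "\<exists>D. ((\<lambda>t. \<psi> ((x, y) + t *\<^sub>R (b, 0)) \<bullet> (b, 0)) has_field_derivative D) (at 0)"
        by blast
      then show "\<exists>D. ((\<lambda>t. ?G t y) has_field_derivative D) (at 0)"
        by (simp add: inner_prod_def)
    qed
    have V: "(LINT y|lborel. ?G t y) = vertical_integral \<psi> (x + t *\<^sub>R b) \<bullet> b" for t
      unfolding vertical_integral_def by (rule integral_inner_left) (rule int)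
    note * = has_derivative_integral_lipschitz[of ?G, OF 1 2 3]
    show ?thesis
      using *(1) DERIV_imp_deriv[OF *(2)] unfolding V by simp
  qed
  let ?g = "\<lambda>y. snd (\<psi> (x, y))"
  have lip_g: "L-lipschitz_on UNIV ?g"
  proof (rule lipschitz_onI)
    fix y y' :: real
    have "dist (?g y) (?g y') \<le> dist (\<psi> (x, y)) (\<psi> (x, y'))"
      by (rule dist_snd_le)
    also have "\<dots> \<le> L * dist (x, y) (x, y')"
      by (rule lipschitz_onD[OF lip]) auto
    finally show "dist (?g y) (?g y') \<le> L * dist y y'"
      by (simp add: dist_Pair_Pair)
  qed (rule lipschitz_on_nonneg[OF lip])
  have ex_g: "AE y in lborel. \<exists>D. ((\<lambda>t. ?g (y + t)) has_field_derivative D) (at 0)"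
    using ex
  proof (rule AE_mp, intro AE_I2 impI)
    fix y assume "\<forall>b\<in>Basis. \<exists>D. ((\<lambda>t. \<psi> ((x, y) + t *\<^sub>R b) \<bullet> b) has_field_derivative D) (at 0)"
    moreover have "(0, 1) \<in> (Basis :: ('a \<times> real) set)"
      by (simp add: Basis_prod_def)
    ultimately have "\<exists>D. ((\<lambda>t. \<psi> ((x, y) + t *\<^sub>R (0, 1)) \<bullet> (0, 1)) has_field_derivative D) (at 0)"
      by blast
    then show "\<exists>D. ((\<lambda>t. ?g (y + t)) has_field_derivative D) (at 0)"
      by (simp add: inner_prod_def)
  qed
  note ver = integral_deriv_compactly_supported[OF lip_g _ ex_g, of R]
  have "divergence (vertical_integral \<psi>) x =
      (\<Sum>b\<in>Basis. LINT y|lebesgue. deriv (\<lambda>t. fst (\<psi> (x + t *\<^sub>R b, y)) \<bullet> b) 0) +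
      (LINT y|lebesgue. deriv (\<lambda>t. ?g (y + t)) 0)"
    unfolding divergence_def using hor ver(2) R by simp
  also have "\<dots> = (LINT y|lebesgue. (\<Sum>b\<in>Basis. deriv (\<lambda>t. fst (\<psi> (x + t *\<^sub>R b, y)) \<bullet> b) 0) +
      deriv (\<lambda>t. ?g (y + t)) 0)"
    using hor ver(1) R by (subst Bochner_Integration.integral_add) (auto intro!: Bochner_Integration.integrable_sum Bochner_Integration.integral_sum[symmetric])
  finally show ?thesis
    unfolding divergence_prod .
qed

lemma borel_measurable_section:
  fixes F :: "'a::euclidean_space \<times> 'b::euclidean_space \<Rightarrow> 'c::topological_space"
  assumes "F \<in> borel_measurable borel"
  shows "(\<lambda>y. F (x, y)) \<in> borel_measurable borel"
proof (rule measurable_compose[OF _ assms])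
  show "Pair x \<in> borel_measurable borel"
    by (intro borel_measurable_continuous_onI continuous_intros)
qed

text \<open>Fubini's theorem with the preceding lemma: \<open>J f\<close> is constant on vertical lines, so the inner integral
of \<open>J f * divergence \<psi>\<close> is \<open>f x\<close> times the divergence of the vertical integral. Both factors are first
replaced by Borel functions, and the divergence is cut off outside \<open>K\<close>. The product is then integrable
because the divergence is bounded and \<open>J f\<close> has finite norm on the subgraph.\<close>

lemma integral_divergence_subgraph:
  fixes f :: "'a::euclidean_space \<Rightarrow> real" and \<psi> :: "'a \<times> real \<Rightarrow> 'a \<times> real"
  assumes w: "lower_semicontinuous w" and \<Omega>: "open \<Omega>" and f: "f \<in> L1 \<Omega> w"
    and lip: "L-lipschitz_on UNIV \<psi>"
    and K: "compact K" "K \<subseteq> subgraph \<Omega> w" "\<And>z. z \<notin> K \<Longrightarrow> \<psi> z = 0"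
  shows "(LINT z:subgraph \<Omega> w|lebesgue. J f z * divergence \<psi> z) =
         (LINT x:\<Omega>|lebesgue. f x * divergence (vertical_integral \<psi>) x)"
proof -
  let ?S = "subgraph \<Omega> w" and ?V = "vertical_integral \<psi>"
  note borel_measurable_fst [measurable]
  have S [measurable]: "?S \<in> sets borel"
    using open_subgraph[OF w \<Omega>] by (rule borel_open)
  have cK: "closed K" and [measurable]: "K \<in> sets borel"
    using K(1) by (auto intro: compact_imp_closed borel_compact)
  obtain R where R0: "0 \<le> R" and R: "\<And>x y. R < \<bar>y\<bar> \<Longrightarrow> (x, y) \<notin> K"
    by (rule compact_support_vertical_bound[OF K(1)]) (rule that; blast)
  have f_meas: "f \<in> borel_measurable (lebesgue_on \<Omega>)" and f_fin: "L1_norm \<Omega> w f < \<infinity>"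
    using f by (auto simp: L1_def)
  obtain f0 where f0 [measurable]: "f0 \<in> borel_measurable borel"
    and f0_eq: "AE x in lborel. indicator \<Omega> x * f x = f0 x"
    by (rule borel_representative[OF f_meas \<Omega>])
  obtain D' where D' [measurable]: "D' \<in> borel_measurable borel"
    and D'_eq: "AE z in lborel. divergence \<psi> z = D' z"
    using completion_ex_borel_measurable_real[OF borel_measurable_divergence[OF lip]] by auto
  define D where "D z = indicator K z * D' z" for z
  have D [measurable]: "D \<in> borel_measurable borel"
    unfolding D_def by measurable
  have div_out: "divergence \<psi> z = 0" if "z \<notin> K" for z
    using cK K(3) that by (rule divergence_eq_0_outside)
  have D_eq: "AE z in lborel. D z = divergence \<psi> z"
    using D'_eq
  proof eventually_elim
    case (elim z)
    then show ?case
      by (cases "z \<in> K") (simp_all add: D_def div_out)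
  qed
  define G where "G z = f0 (fst z) * D z" for z
  have G [measurable]: "G \<in> borel_measurable borel"
    unfolding G_def by measurable
  have ex: "AE z in lborel. \<forall>b\<in>Basis. \<exists>D. ((\<lambda>t. \<psi> (z + t *\<^sub>R b) \<bullet> b) has_field_derivative D) (at 0)"
    by (rule lipschitz_AE_partial_derivatives[OF lip])

  have "AE z in lborel. indicator ?S z * (J f z * divergence \<psi> z) = G z"
    using AE_lborel_fst[OF f0_eq] D_eq
  proof eventually_elim
    case (elim z)
    show ?case
    proof (cases "z \<in> K")
      case True
      then have "z \<in> ?S" "fst z \<in> \<Omega>"
        using K(2) by (auto simp: subgraph_def)
      then show ?thesis
        using elim by (simp add: G_def J_def case_prod_unfold)
    next
      case False
      then show ?thesis
        by (simp add: G_def D_def div_out)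
    qed
  qed
  then have "(LINT z:?S|lebesgue. J f z * divergence \<psi> z) = (LINT z|lebesgue. G z)"
    unfolding set_lebesgue_integral_def real_scaleR_def by (rule integral_lebesgue_cong_AE)
  also have "\<dots> = (LINT z|lborel. G z)"
    by (rule integral_completion) simp
  also have "\<dots> = (LINT x|lborel. LINT y|lborel. G (x, y))"
  proof -
    let ?C = "DIM('a \<times> real) * L"
    have "integrable lborel G"
    proof (rule integrableI_bounded)
      have "(\<integral>\<^sup>+z. ennreal (norm (G z)) \<partial>lborel) \<le>
            (\<integral>\<^sup>+z. ennreal ?C * (ennreal \<bar>f0 (fst z)\<bar> * indicator ?S z) \<partial>lborel)"
      proof (rule nn_integral_mono_AE)
        show "AE z in lborel. ennreal (norm (G z)) \<le> ennreal ?C * (ennreal \<bar>f0 (fst z)\<bar> * indicator ?S z)"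
          using D_eq ex
        proof eventually_elim
          case (elim z)
          show ?case
          proof (cases "z \<in> K")
            case True
            have "\<bar>D z\<bar> \<le> ?C"
              using lipschitz_divergence_bound[OF lip elim(2)] elim(1) by simp
            then have "\<bar>D z\<bar> * \<bar>f0 (fst z)\<bar> \<le> ?C * \<bar>f0 (fst z)\<bar>"
              by (rule mult_right_mono) (rule abs_ge_zero)
            then have "ennreal (norm (G z)) \<le> ennreal (?C * \<bar>f0 (fst z)\<bar>)"
              unfolding G_def real_norm_def abs_mult by (subst mult.commute) (rule ennreal_leI)
            also have "\<dots> = ennreal ?C * ennreal \<bar>f0 (fst z)\<bar>"
              by (rule ennreal_mult'') simp
            finally show ?thesis
              using True K(2) by (auto simp: indicator_def)
          next
            case False
            then show ?thesis by (simp add: G_def D_def)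
          qed
        qed
      qed
      also have "\<dots> = ennreal ?C * (\<integral>\<^sup>+z. ennreal \<bar>f0 (fst z)\<bar> * indicator ?S z \<partial>lborel)"
        by (rule nn_integral_cmult) measurable
      also have "(\<integral>\<^sup>+z. ennreal \<bar>f0 (fst z)\<bar> * indicator ?S z \<partial>lborel) =
                 (\<integral>\<^sup>+z. ennreal \<bar>J f z\<bar> * indicator ?S z \<partial>lborel)"
        by (rule nn_integral_cong_AE, rule AE_mp[OF AE_lborel_fst[OF f0_eq]], intro AE_I2 impI)
           (auto simp: J_def indicator_def subgraph_def split: if_splits)
      also have "\<dots> = L1_norm ?S unit_weight (J f)"
        by (simp add: L1_norm_def nn_integral_completion)
      also have "\<dots> = L1_norm \<Omega> w f"
        by (rule L1_norm_subgraph[OF w \<Omega> f_meas])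
      also have "ennreal ?C * L1_norm \<Omega> w f < \<infinity>"
        using f_fin by (simp add: ennreal_mult_less_top)
      finally show "(\<integral>\<^sup>+z. ennreal (norm (G z)) \<partial>lborel) < \<infinity>" .
    qed simp
    then have "integrable (lborel \<Otimes>\<^sub>M lborel) G"
      unfolding lborel_prod .
    from lborel_pair.integral_fst'[OF this] show ?thesis
      unfolding lborel_prod by simp
  qed
  also have "\<dots> = (LINT x|lebesgue. LINT y|lborel. G (x, y))"
  proof (rule integral_completion[symmetric])
    have "G \<in> borel_measurable (lborel \<Otimes>\<^sub>M lborel)"
      unfolding lborel_prod by simp
    then show "(\<lambda>x. LINT y|lborel. G (x, y)) \<in> borel_measurable lborel"
      by (intro lborel.borel_measurable_lebesgue_integral) simp
  qed
  also have "\<dots> = (LINT x:\<Omega>|lebesgue. f x * divergence ?V x)"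
    unfolding set_lebesgue_integral_def real_scaleR_def
  proof (rule integral_lebesgue_cong_AE)
    show "AE x in lborel. (LINT y|lborel. G (x, y)) = indicator \<Omega> x * (f x * divergence ?V x)"
      using AE_lborel_sections[OF D_eq] AE_lborel_sections[OF ex] f0_eq
    proof eventually_elim
      case (elim x)
      have "(LINT y|lborel. G (x, y)) = f0 x * (LINT y|lborel. D (x, y))"
        by (simp add: G_def)
      also have "(LINT y|lborel. D (x, y)) = (LINT y|lebesgue. D (x, y))"
        using borel_measurable_section[OF D] by (intro integral_completion[symmetric]) simp
      also have "\<dots> = (LINT y|lebesgue. divergence \<psi> (x, y))"
        using elim(1) by (rule integral_lebesgue_cong_AE)
      also have "\<dots> = divergence ?V x"
        using lip K(3)[OF R] elim(2) by (rule divergence_vertical_integral[symmetric])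
      finally show ?case
        using elim(3) by simp
    qed
  qed
  finally show ?thesis .
qed

section \<open>Every field strictly below the weight is a vertical integral\<close>

text \<open>A continuous step from \<open>0\<close> to \<open>1\<close> that takes place between \<open>a\<close> and \<open>2 * a\<close>.\<close>

definition ramp :: "real \<Rightarrow> real \<Rightarrow> real" where
  "ramp a y = max 0 (min 1 (y / a - 1))"

text \<open>A trapezoidal profile as a difference of two shifted steps. With this form its integral is exactly
the shift \<open>m\<close>, and it is Lipschitz in \<open>m\<close> and \<open>y\<close> together.\<close>

definition plateau :: "real \<Rightarrow> real \<Rightarrow> real \<Rightarrow> real" where
  "plateau a m y = ramp a y - ramp a (y - m)"

lemma ramp_lipschitz:
  assumes "0 < a"
  shows "\<bar>ramp a y - ramp a z\<bar> \<le> \<bar>y - z\<bar> / a"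
proof -
  have "\<bar>max 0 (min 1 u) - max 0 (min 1 v)\<bar> \<le> \<bar>u - v\<bar>" for u v :: real
    by (auto simp: max_def min_def)
  then have "\<bar>ramp a y - ramp a z\<bar> \<le> \<bar>(y / a - 1) - (z / a - 1)\<bar>"
    unfolding ramp_def .
  also have "\<dots> = \<bar>y - z\<bar> / a"
    using assms by (simp add: abs_divide flip: diff_divide_distrib)
  finally show ?thesis .
qed

lemma plateau_lipschitz:
  assumes "0 < a"
  shows "\<bar>plateau a m y - plateau a m' y'\<bar> \<le> (2 * \<bar>y - y'\<bar> + \<bar>m - m'\<bar>) / a"
proof -
  have "\<bar>ramp a (y - m) - ramp a (y' - m')\<bar> \<le> \<bar>(y - m) - (y' - m')\<bar> / a"
    by (rule ramp_lipschitz[OF assms])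
  also have "\<dots> \<le> (\<bar>y - y'\<bar> + \<bar>m - m'\<bar>) / a"
    using assms by (intro divide_right_mono) auto
  finally show ?thesis
    using ramp_lipschitz[OF assms, of y y'] unfolding plateau_def
    by (simp add: add_divide_distrib)
qed

lemma plateau_bounds:
  assumes "0 < a" "0 \<le> m"
  shows "0 \<le> plateau a m y" "plateau a m y \<le> 1"
proof -
  have "(y - m) / a \<le> y / a"
    using assms by (intro divide_right_mono) auto
  then show "0 \<le> plateau a m y" "plateau a m y \<le> 1"
    by (auto simp: plateau_def ramp_def max_def min_def)
qed

lemma plateau_eq_0:
  assumes "0 < a" "0 \<le> m" "y \<le> a \<or> m + 2 * a \<le> y"
  shows "plateau a m y = 0"
  using assms(3)
proof
  assume "y \<le> a"
  then have "y / a \<le> 1" "(y - m) / a \<le> 1"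
    using assms by (auto simp: divide_le_eq)
  then show ?thesis by (simp add: plateau_def ramp_def)
next
  assume "m + 2 * a \<le> y"
  then have "2 \<le> y / a" "2 \<le> (y - m) / a"
    using assms by (auto simp: le_divide_eq)
  then show ?thesis by (simp add: plateau_def ramp_def)
qed

text \<open>The ramp differs from the indicator of a half-line by an integrable function \<open>r\<close>. In the difference of
the two ramps the contributions of \<open>r\<close> cancel by translation invariance, and the indicators leave an
interval of length \<open>m\<close>.\<close>

lemma integral_plateau:
  assumes a: "0 < a" and m: "0 \<le> m"
  shows "(LINT y|lborel. plateau a m y) = m"
proof -
  define r where "r y = indicator {a..2 * a} y * ramp a y" for y
  have ramp: "ramp a y = indicator {2 * a<..} y + r y" for y
    using a by (auto simp: ramp_def r_def indicator_def max_def min_def field_simps)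
  have plateau: "plateau a m y = indicator {2 * a<..2 * a + m} y + (r y - r (y - m))" for y
    using m unfolding plateau_def ramp by (auto simp: indicator_def)
  have "continuous_on UNIV (ramp a)"
    unfolding ramp_def using a by (intro continuous_intros) auto
  then have r: "integrable lborel r"
    using borel_integrable_compact[of "{a..2 * a}" "ramp a"] continuous_on_subset
    unfolding r_def by (fastforce simp: real_scaleR_def)
  have r_shift: "integrable lborel (\<lambda>y. r (y - m))" "(LINT y|lborel. r (y - m)) = (LINT y|lborel. r y)"
    using lborel_integrable_real_affine[OF r, of 1 "- m"] lborel_integral_real_affine[of 1 r "- m"] by simp_all
  have ind: "integrable lborel (indicator {2 * a<..2 * a + m} :: real \<Rightarrow> real)"
    using m by (intro integrable_real_indicator) (simp_all add: emeasure_lborel_Ioc)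
  have "(LINT y|lborel. plateau a m y) = (LINT y|lborel. indicator {2 * a<..2 * a + m} y) + ((LINT y|lborel. r y) - (LINT y|lborel. r (y - m)))"
    unfolding plateau using ind r r_shift(1) by simp
  also have "\<dots> = m"
    using m r_shift(2) by simp
  finally show ?thesis .
qed

lemma lipschitz_normalize:
  fixes u v :: "'a::real_normed_vector"
  assumes "0 < e"
  shows "norm (u /\<^sub>R (norm u + e) - v /\<^sub>R (norm v + e)) \<le> 2 / e * norm (u - v)"
proof -
  let ?p = "norm u + e" and ?q = "norm v + e"
  have p: "0 < ?p" "e \<le> ?p" and q: "0 < ?q" "e \<le> ?q"
    using assms by (auto simp: add_nonneg_pos)
  have inv: "inverse ?p \<le> 1 / e"
    using le_imp_inverse_le[OF p(2) assms] by (simp add: inverse_eq_divide)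
  have "u /\<^sub>R ?p - v /\<^sub>R ?q = inverse ?p *\<^sub>R (u - v) + (inverse ?p - inverse ?q) *\<^sub>R v"
    by (simp add: scaleR_diff_left scaleR_diff_right)
  also have "norm \<dots> \<le> inverse ?p * norm (u - v) + \<bar>inverse ?p - inverse ?q\<bar> * norm v"
    using p by (intro order_trans[OF norm_triangle_ineq]) simp
  also have "\<bar>inverse ?p - inverse ?q\<bar> * norm v = inverse ?p * (\<bar>norm v - norm u\<bar> * (norm v / ?q))"
  proof -
    have "inverse ?p - inverse ?q = inverse ?p * ((norm v - norm u) / ?q)"
      using p q by (simp add: field_simps)
    then show ?thesis
      using p q by (simp add: abs_mult)
  qed
  also have "\<dots> \<le> inverse ?p * (norm (u - v) * 1)"
  proof (intro mult_left_mono mult_mono)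
    show "\<bar>norm v - norm u\<bar> \<le> norm (u - v)"
      using norm_triangle_ineq3[of v u] by (simp add: norm_minus_commute)
    show "norm v / ?q \<le> 1"
      using assms by (subst divide_le_eq_1_pos[OF q(1)]) simp
  qed (use p q in auto)
  also have "inverse ?p * norm (u - v) + inverse ?p * (norm (u - v) * 1) = inverse ?p * (2 * norm (u - v))"
    by simp
  also have "\<dots> \<le> 1 / e * (2 * norm (u - v))"
    using inv by (intro mult_right_mono) auto
  finally show ?thesis
    by simp
qed

text \<open>The graph of \<open>norm (\<phi> x)\<close> over \<open>K\<close> is compact and lies in the open set of points below \<open>w\<close>, hence has
a positive distance to its complement. This covers infinite values of \<open>w\<close> without a case distinction.\<close>

lemma uniform_gap_below_weight:
  fixes \<phi> :: "'a::euclidean_space \<Rightarrow> 'a"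
  assumes w: "lower_semicontinuous w" and cont: "continuous_on UNIV \<phi>" and K: "compact K"
    and less: "\<And>x. x \<in> K \<Longrightarrow> ennreal (norm (\<phi> x)) < w x"
  obtains e where "0 < e" "\<And>x. x \<in> K \<Longrightarrow> ennreal (norm (\<phi> x) + e) < w x"
proof -
  let ?A = "(\<lambda>x. (x, norm (\<phi> x))) ` K" and ?V = "{(x, y). ennreal y < w x}"
  have cpt: "compact ?A"
    using K by (intro compact_continuous_image continuous_intros continuous_on_subset[OF cont]) auto
  have sub: "?A \<subseteq> ?V"
    using less by auto
  obtain d where d: "0 < d" "(\<Union>z\<in>?A. ball z d) \<subseteq> ?V"
    by (rule compact_subset_open_imp_ball_epsilon_subset[OF cpt open_below_lower_semicontinuous[OF w] sub])
  have "ennreal (norm (\<phi> x) + d / 2) < w x" if "x \<in> K" for x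
  proof -
    have "(x, norm (\<phi> x) + d / 2) \<in> ball (x, norm (\<phi> x)) d"
      using d(1) by (simp add: dist_Pair_Pair dist_real_def)
    then have "(x, norm (\<phi> x) + d / 2) \<in> ?V"
      using d(2) that by blast
    then show ?thesis by simp
  qed
  then show thesis
    using d(1) by (intro that[of "d / 2"]) auto
qed

text \<open>The mass of \<open>\<phi> x\<close> is spread over the vertical line with the profile \<open>plateau a (m x)\<close>, whose height is
at most \<open>1\<close> and whose integral is \<open>m x = norm (\<phi> x) + 2 * a\<close>. Multiplied by the vector \<open>\<phi> x / m x\<close> of
norm at most \<open>1\<close>, it integrates to \<open>\<phi> x\<close>. The profile is supported in heights between \<open>a\<close> and
\<open>norm (\<phi> x) + 4 * a\<close>; the gap \<open>4 * a\<close> below the weight keeps this inside the subgraph.\<close>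

lemma vertical_integral_surjective:
  fixes \<phi> :: "'a::euclidean_space \<Rightarrow> 'a"
  assumes w: "lower_semicontinuous w" and lip: "L-lipschitz_on UNIV \<phi>"
    and K: "compact K" "K \<subseteq> \<Omega>" "\<And>x. x \<notin> K \<Longrightarrow> \<phi> x = 0"
    and less: "\<And>x. x \<in> K \<Longrightarrow> ennreal (norm (\<phi> x)) < w x"
  shows "\<exists>L' K' \<psi>. L'-lipschitz_on UNIV \<psi> \<and> compact K' \<and> K' \<subseteq> subgraph \<Omega> w \<and>
    (\<forall>z. z \<notin> K' \<longrightarrow> \<psi> z = 0) \<and> (\<forall>z. norm (\<psi> z) \<le> 1) \<and> vertical_integral \<psi> = \<phi>"
proof -
  have L: "0 \<le> L"
    using lip by (rule lipschitz_on_nonneg)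
  have cont: "continuous_on UNIV \<phi>"
    using lip by (rule lipschitz_on_continuous_on)
  obtain e where e: "0 < e" "\<And>x. x \<in> K \<Longrightarrow> ennreal (norm (\<phi> x) + e) < w x"
    by (rule uniform_gap_below_weight[OF w cont K(1) less]) (assumption, rule that, assumption, blast)
  define a where "a = e / 4"
  have a: "0 < a"
    using e(1) by (simp add: a_def)
  define m where "m x = norm (\<phi> x) + 2 * a" for x
  define \<theta> where "\<theta> x = \<phi> x /\<^sub>R m x" for x
  define \<psi> where "\<psi> z = (plateau a (m (fst z)) (snd z) *\<^sub>R \<theta> (fst z), 0 :: real)" for z
  have m: "0 < m x" "0 \<le> m x" "norm (\<phi> x) \<le> m x" for x
    using a by (auto simp: m_def add_nonneg_pos)
  have lip_\<phi>: "norm (\<phi> x - \<phi> x') \<le> L * norm (x - x')" for x x'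
    using lipschitz_onD[OF lip, of x x'] by (simp add: dist_norm)
  have \<theta>1: "norm (\<theta> x) \<le> 1" for x
  proof -
    have "norm (\<theta> x) = norm (\<phi> x) / m x"
      using m[of x] by (simp add: \<theta>_def divide_inverse mult.commute)
    also have "\<dots> \<le> 1"
      using m[of x] by (subst divide_le_eq_1_pos) auto
    finally show ?thesis .
  qed
  have lip_\<theta>: "norm (\<theta> x - \<theta> x') \<le> L / a * norm (x - x')" for x x'
  proof -
    have "norm (\<theta> x - \<theta> x') \<le> 2 / (2 * a) * norm (\<phi> x - \<phi> x')"
      unfolding \<theta>_def m_def using a by (intro lipschitz_normalize) simp
    also have "\<dots> \<le> 2 / (2 * a) * (L * norm (x - x'))"
      using a by (intro mult_left_mono lip_\<phi>) simp
    finally show ?thesis by simp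
  qed
  have lip_p: "\<bar>plateau a (m x) y - plateau a (m x') y'\<bar> \<le> (2 + L) / a * dist (x, y) (x', y')" for x x' y y'
  proof -
    have "\<bar>m x - m x'\<bar> \<le> L * norm (x - x')"
      using norm_triangle_ineq3[of "\<phi> x" "\<phi> x'"] lip_\<phi>[of x x'] by (simp add: m_def)
    also have "\<dots> \<le> L * dist (x, y) (x', y')"
      using L dist_fst_le[of "(x, y)" "(x', y')"] by (intro mult_left_mono) (auto simp: dist_norm)
    finally have "2 * \<bar>y - y'\<bar> + \<bar>m x - m x'\<bar> \<le> (2 + L) * dist (x, y) (x', y')"
      using dist_snd_le[of "(x, y)" "(x', y')"] by (simp add: dist_real_def algebra_simps)
    then have "(2 * \<bar>y - y'\<bar> + \<bar>m x - m x'\<bar>) / a \<le> (2 + L) * dist (x, y) (x', y') / a"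
      using a by (intro divide_right_mono) auto
    then show ?thesis
      using plateau_lipschitz[OF a, of "m x" y "m x'" y'] by simp
  qed
  have lip_\<psi>: "((2 + L) / a + L / a)-lipschitz_on UNIV \<psi>"
  proof (rule lipschitz_onI)
    fix z z' :: "'a \<times> real"
    obtain x y x' y' where z: "z = (x, y)" "z' = (x', y')"
      by (metis surj_pair)
    let ?k = "plateau a (m x) y" and ?k' = "plateau a (m x') y'"
    have "dist (\<psi> z) (\<psi> z') = norm (?k *\<^sub>R \<theta> x - ?k' *\<^sub>R \<theta> x')"
      by (simp add: z \<psi>_def dist_Pair_Pair dist_norm)
    also have "?k *\<^sub>R \<theta> x - ?k' *\<^sub>R \<theta> x' = (?k - ?k') *\<^sub>R \<theta> x + ?k' *\<^sub>R (\<theta> x - \<theta> x')"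
      by (simp add: scaleR_diff_left scaleR_diff_right)
    also have "norm \<dots> \<le> \<bar>?k - ?k'\<bar> * norm (\<theta> x) + \<bar>?k'\<bar> * norm (\<theta> x - \<theta> x')"
      by (intro order_trans[OF norm_triangle_ineq]) simp
    also have "\<dots> \<le> \<bar>?k - ?k'\<bar> * 1 + 1 * norm (\<theta> x - \<theta> x')"
      using plateau_bounds[OF a m(2)[of x'], of y'] \<theta>1[of x]
      by (intro add_mono mult_left_mono mult_right_mono) auto
    also have "\<dots> \<le> (2 + L) / a * dist (x, y) (x', y') + L / a * dist (x, y) (x', y')"
    proof -
      have "norm (\<theta> x - \<theta> x') \<le> L / a * norm (x - x')"
        by (rule lip_\<theta>)
      also have "\<dots> \<le> L / a * dist (x, y) (x', y')"
        using L a dist_fst_le[of "(x, y)" "(x', y')"] by (intro mult_left_mono) (auto simp: dist_norm)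
      finally show ?thesis
        using lip_p[of x y x' y'] by simp
    qed
    finally show "dist (\<psi> z) (\<psi> z') \<le> ((2 + L) / a + L / a) * dist z z'"
      by (simp add: z distrib_right)
  qed (use L a in simp)
  \<comment> \<open>The supports of the vertical profiles over all of \<open>K\<close>, as the image of a compact set under a continuous map.\<close>
  define K' where "K' = (\<lambda>(x, s). (x, a + s * (norm (\<phi> x) + 3 * a))) ` (K \<times> {0..1})"
  have K'_cpt: "compact K'"
    unfolding K'_def case_prod_unfold using K(1)
    by (intro compact_continuous_image compact_Times compact_Icc continuous_intros
        continuous_on_compose2[OF cont]) auto
  have K'_sub: "K' \<subseteq> subgraph \<Omega> w"
  proof
    fix z assume "z \<in> K'"
    then obtain x s where xs: "x \<in> K" "0 \<le> s" "s \<le> 1" "z = (x, a + s * (norm (\<phi> x) + 3 * a))"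
      by (auto simp: K'_def)
    let ?y = "a + s * (norm (\<phi> x) + 3 * a)"
    have "s * (norm (\<phi> x) + 3 * a) \<le> 1 * (norm (\<phi> x) + 3 * a)"
      using xs a by (intro mult_right_mono) auto
    then have "?y \<le> norm (\<phi> x) + e"
      by (simp add: a_def)
    then have "ennreal ?y < w x"
      using e(2)[OF xs(1)] by (meson ennreal_leI le_less_trans)
    moreover have "0 < ?y"
      using xs a by (intro add_pos_nonneg mult_nonneg_nonneg) auto
    ultimately show "z \<in> subgraph \<Omega> w"
      using xs K(2) by (auto simp: subgraph_def)
  qed
  have K'_zero: "\<psi> z = 0" if "z \<notin> K'" for z
  proof (rule ccontr)
    assume nz: "\<psi> z \<noteq> 0"
    obtain x y where z: "z = (x, y)"
      by (metis surj_pair)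
    have p: "plateau a (m x) y \<noteq> 0" and "\<phi> x \<noteq> 0"
      using nz by (auto simp: \<psi>_def z \<theta>_def zero_prod_def)
    then have x: "x \<in> K"
      using K(3) by blast
    have y: "a < y" "y < norm (\<phi> x) + 4 * a"
      using p plateau_eq_0[OF a m(2)[of x], of y] by (force simp: m_def)+
    define s where "s = (y - a) / (norm (\<phi> x) + 3 * a)"
    have pos: "0 < norm (\<phi> x) + 3 * a"
      using a by (simp add: add_nonneg_pos)
    then have "0 \<le> s" "s \<le> 1" "y = a + s * (norm (\<phi> x) + 3 * a)"
      using y by (auto simp: s_def divide_le_eq)
    then have "z \<in> K'"
      unfolding K'_def z using x by force
    then show False using that by simp
  qed
  have \<psi>1: "norm (\<psi> z) \<le> 1" for z
  proof -
    have "norm (\<psi> z) = \<bar>plateau a (m (fst z)) (snd z)\<bar> * norm (\<theta> (fst z))"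
      by (simp add: \<psi>_def)
    also have "\<dots> \<le> 1 * 1"
      using plateau_bounds[OF a m(2)[of "fst z"], of "snd z"] \<theta>1 by (intro mult_mono) auto
    finally show ?thesis by simp
  qed
  have "vertical_integral \<psi> x = \<phi> x" for x
  proof -
    have "integrable lborel (plateau a (m x))"
      using integral_plateau[OF a m(2)[of x]] m(1)[of x] not_integrable_integral_eq by fastforce
    then have "vertical_integral \<psi> x = (LINT y|lborel. plateau a (m x) y) *\<^sub>R \<theta> x"
      by (simp add: vertical_integral_def \<psi>_def)
    also have "\<dots> = \<phi> x"
      using m(1)[of x] by (simp add: integral_plateau[OF a m(2)] \<theta>_def)
    finally show ?thesis .
  qed
  then show ?thesis
    using lip_\<psi> K'_cpt K'_sub K'_zero \<psi>1 by blast
qed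

section \<open>The isometric embedding\<close>

text \<open>The scaling rule holds almost everywhere only: where a partial derivative does not exist, the
unspecified value of the divergence does not scale with \<open>c\<close>.\<close>

lemma integral_divergence_scale:
  fixes \<phi> :: "'a::euclidean_space \<Rightarrow> 'a" and f :: "'a \<Rightarrow> real"
  assumes "L-lipschitz_on UNIV \<phi>"
  shows "(LINT x:\<Omega>|lebesgue. f x * divergence (\<lambda>x. c *\<^sub>R \<phi> x) x) = c * (LINT x:\<Omega>|lebesgue. f x * divergence \<phi> x)"
proof -
  have "AE x in lborel. indicator \<Omega> x * (f x * divergence (\<lambda>x. c *\<^sub>R \<phi> x) x) = c * (indicator \<Omega> x * (f x * divergence \<phi> x))"
    using lipschitz_AE_partial_derivatives[OF assms]
  proof eventually_elim
    case (elim x)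
    have "divergence (\<lambda>x. c *\<^sub>R \<phi> x) x = c * divergence \<phi> x"
      unfolding divergence_def sum_distrib_left
    proof (rule sum.cong[OF refl])
      fix b :: 'a assume "b \<in> Basis"
      then have "((\<lambda>t. \<phi> (x + t *\<^sub>R b) \<bullet> b) has_field_derivative deriv (\<lambda>t. \<phi> (x + t *\<^sub>R b) \<bullet> b) 0) (at 0)"
        using elim DERIV_imp_deriv by blast
      from DERIV_cmult[OF this, of c]
      show "deriv (\<lambda>t. (c *\<^sub>R \<phi> (x + t *\<^sub>R b)) \<bullet> b) 0 = c * deriv (\<lambda>t. \<phi> (x + t *\<^sub>R b) \<bullet> b) 0"
        using DERIV_imp_deriv by simp
    qed
    then show ?case by simp
  qed
  then have "(LINT x:\<Omega>|lebesgue. f x * divergence (\<lambda>x. c *\<^sub>R \<phi> x) x) =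
      (LINT x|lebesgue. c * (indicator \<Omega> x * (f x * divergence \<phi> x)))"
    unfolding set_lebesgue_integral_def real_scaleR_def by (rule integral_lebesgue_cong_AE)
  then show ?thesis
    by (simp add: set_lebesgue_integral_def)
qed

lemma ereal_le_if_scaled_le:
  fixes I :: real
  assumes "\<And>c. 0 < c \<Longrightarrow> c < 1 \<Longrightarrow> ereal (c * I) \<le> T"
  shows "ereal I \<le> T"
proof (cases T)
  case (real r)
  have "I \<le> r"
    by (rule field_le_mult_one_interval) (use assms real in auto)
  then show ?thesis using real by simp
next
  case MInf
  then show ?thesis using assms[of "1 / 2"] by simp
qed simp

text \<open>Vertical integration maps the competitors on the subgraph to competitors on \<open>\<Omega>\<close>, which gives \<open>\<ge>\<close>.
For \<open>\<le>\<close> a competitor \<open>\<phi>\<close> on \<open>\<Omega>\<close> is shrunk to \<open>c *\<^sub>R \<phi>\<close> with \<open>c < 1\<close>, which lies strictly below the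
positive weight and hence is the vertical integral of a competitor on the subgraph; then \<open>c\<close> tends
to \<open>1\<close>.\<close>

theorem total_variation_subgraph:
  fixes f :: "'a::euclidean_space \<Rightarrow> real"
  assumes w: "\<forall>x. 0 < w x" "lower_semicontinuous w" and \<Omega>: "open \<Omega>" and f: "f \<in> L1 \<Omega> w"
  shows "total_variation \<Omega> w f = total_variation (subgraph \<Omega> w) unit_weight (J f)"
proof (rule antisym)
  let ?S = "subgraph \<Omega> w"
  have S: "open ?S"
    by (rule open_subgraph[OF w(2) \<Omega>])
  show "total_variation ?S unit_weight (J f) \<le> total_variation \<Omega> w f"
    unfolding total_variation_eq_SUP_global[OF S] 
  proof (rule SUP_least, clarify)
    fix \<psi> :: "'a \<times> real \<Rightarrow> 'a \<times> real" and L K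
    assume \<psi>: "L-lipschitz_on UNIV \<psi>" "compact K" "K \<subseteq> ?S" "\<forall>z. z \<notin> K \<longrightarrow> \<psi> z = 0"
      "\<forall>z\<in>?S. ennreal (norm (\<psi> z)) \<le> 1"
    let ?V = "vertical_integral \<psi>"
    obtain R where R: "0 \<le> R" "\<And>x y. R < \<bar>y\<bar> \<Longrightarrow> (x, y) \<notin> K"
      by (rule compact_support_vertical_bound[OF \<psi>(2)]) (rule that; blast)
    have zero: "\<psi> z = 0" if "z \<notin> K" for z
      using \<psi>(4) that by blast
    have "(L * (2 * R))-lipschitz_on UNIV ?V"
      using \<psi>(1) R(1) zero[OF R(2)] by (rule vertical_integral_lipschitz)
    moreover have "compact (fst ` K)"
      using \<psi>(2) by (intro compact_continuous_image continuous_intros)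
    moreover have "fst ` K \<subseteq> \<Omega>"
      using \<psi>(3) by (auto simp: subgraph_def)
    moreover have "\<forall>x. x \<notin> fst ` K \<longrightarrow> ?V x = 0"
      using vertical_integral_eq_0[of K \<psi>, OF zero] by blast
    moreover have "\<forall>x\<in>\<Omega>. ennreal (norm (?V x)) \<le> w x"
      using norm_vertical_integral_le[OF lipschitz_on_continuous_on[OF \<psi>(1)] S \<psi>(2,3) zero] \<psi>(5)
      by (simp add: ennreal_le_1)
    ultimately have "ereal (LINT x:\<Omega>|lebesgue. f x * divergence ?V x) \<le> total_variation \<Omega> w f"
      unfolding total_variation_eq_SUP_global[OF \<Omega>] by (intro SUP_upper) blast
    then show "ereal (LINT z:?S|lebesgue. J f z * divergence \<psi> z) \<le> total_variation \<Omega> w f"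
      using integral_divergence_subgraph[OF w(2) \<Omega> f \<psi>(1,2,3) zero] by simp
  qed
  show "total_variation \<Omega> w f \<le> total_variation ?S unit_weight (J f)"
    unfolding total_variation_eq_SUP_global[OF \<Omega>]
  proof (rule SUP_least, clarify)
    fix \<phi> :: "'a \<Rightarrow> 'a" and L K
    assume \<phi>: "L-lipschitz_on UNIV \<phi>" "compact K" "K \<subseteq> \<Omega>" "\<forall>x. x \<notin> K \<longrightarrow> \<phi> x = 0"
      "\<forall>x\<in>\<Omega>. ennreal (norm (\<phi> x)) \<le> w x"
    show "ereal (LINT x:\<Omega>|lebesgue. f x * divergence \<phi> x) \<le> total_variation ?S unit_weight (J f)"
    proof (rule ereal_le_if_scaled_le)
      fix c :: real assume c: "0 < c" "c < 1"
      have lip: "(c * L)-lipschitz_on UNIV (\<lambda>x. c *\<^sub>R \<phi> x)"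
        using lipschitz_on_cmult[OF \<phi>(1), of c] c by simp
      have less: "ennreal (norm (c *\<^sub>R \<phi> x)) < w x" if "x \<in> K" for x
      proof (cases "\<phi> x = 0")
        case True
        then show ?thesis using w(1) by simp
      next
        case False
        then have "ennreal (norm (c *\<^sub>R \<phi> x)) < ennreal (norm (\<phi> x))"
          using c by (intro ennreal_lessI) auto
        also have "\<dots> \<le> w x"
          using \<phi>(3,5) that by blast
        finally show ?thesis .
      qed
      have zero: "c *\<^sub>R \<phi> x = 0" if "x \<notin> K" for x
        using \<phi>(4) that by simp
      obtain L' K' \<psi> where \<psi>: "L'-lipschitz_on UNIV \<psi>" "compact K'" "K' \<subseteq> ?S"
        "\<forall>z. z \<notin> K' \<longrightarrow> \<psi> z = 0" "\<forall>z. norm (\<psi> z) \<le> 1" "vertical_integral \<psi> = (\<lambda>x. c *\<^sub>R \<phi> x)"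
        using vertical_integral_surjective[OF w(2) lip \<phi>(2,3) zero less] by blast
      have "ereal (LINT z:?S|lebesgue. J f z * divergence \<psi> z) \<le> total_variation ?S unit_weight (J f)"
        unfolding total_variation_eq_SUP_global[OF S]
        using \<psi> by (intro SUP_upper) (auto simp: ennreal_le_1)
      moreover have "\<psi> z = 0" if "z \<notin> K'" for z
        using \<psi>(4) that by blast
      ultimately show "ereal (c * (LINT x:\<Omega>|lebesgue. f x * divergence \<phi> x)) \<le> total_variation ?S unit_weight (J f)"
        using integral_divergence_subgraph[OF w(2) \<Omega> f \<psi>(1,2,3)] \<psi>(6)
          integral_divergence_scale[OF \<phi>(1), of \<Omega> f c] by simp
    qed
  qed
qed

theorem theorem1p11:
  fixes w :: "real ^ 'n \<Rightarrow> ennreal" and \<Omega> :: "(real ^ 'n) set"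
  assumes "\<forall>x. 0 < w x" and "lower_semicontinuous w" and "open \<Omega>"
  shows "(\<forall>f\<in>BV \<Omega> w. J f \<in> BV (subgraph \<Omega> w) unit_weight) \<and>
    (\<forall>f\<in>BV \<Omega> w. \<forall>g\<in>BV \<Omega> w.
       (AE z in lebesgue_on (subgraph \<Omega> w). J f z = J g z) \<longleftrightarrow> (AE x in lebesgue_on \<Omega>. f x = g x)) \<and>
    (\<forall>f\<in>BV \<Omega> w. L1_norm \<Omega> w f = L1_norm (subgraph \<Omega> w) unit_weight (J f) \<and>
       total_variation \<Omega> w f = total_variation (subgraph \<Omega> w) unit_weight (J f))"
proof (intro conjI ballI)
  have L1: "f \<in> L1 \<Omega> w" "f \<in> borel_measurable (lebesgue_on \<Omega>)" "total_variation \<Omega> w f < \<infinity>"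
    if "f \<in> BV \<Omega> w" for f
    using that by (auto simp: BV_def L1_def)
  fix f assume f: "f \<in> BV \<Omega> w"
  show norm_eq: "L1_norm \<Omega> w f = L1_norm (subgraph \<Omega> w) unit_weight (J f)"
    using L1_norm_subgraph[OF assms(2,3) L1(2)[OF f]] by (rule sym)
  show tv_eq: "total_variation \<Omega> w f = total_variation (subgraph \<Omega> w) unit_weight (J f)"
    using assms L1(1)[OF f] by (rule total_variation_subgraph)
  have "L1_norm \<Omega> w f < \<infinity>"
    using L1(1)[OF f] by (simp add: L1_def)
  then show "J f \<in> BV (subgraph \<Omega> w) unit_weight"
    using borel_measurable_J[OF assms(2,3) L1(2)[OF f]] L1(3)[OF f] norm_eq tv_eq
    by (simp add: BV_def L1_def)
  show "(AE z in lebesgue_on (subgraph \<Omega> w). J f z = J g z) \<longleftrightarrow> (AE x in lebesgue_on \<Omega>. f x = g x)"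
    if "g \<in> BV \<Omega> w" for g
    by (rule AE_J_eq_iff[OF assms(2,1,3) L1(2)[OF f] L1(2)[OF that]])
qed

end
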